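(* Let $n,\nu$ be non-negative integers satisfying $0\le\nu\le\lfloor n/2\rfloor-1$, and let $\alpha^{n,\nu}$ be the pseudo-spline mask with symbol $$\alpha^{n,\nu}(z)=\frac{z^{-\lfloor n/2\rfloor}(1+z)^n}{2^{n-1}}\sum_{j=0}^{\nu}\binom{n/2+j-1}{j}\left(\frac12-\frac{z+z^{-1}}{4}\right)^j .$$ Let $\alpha^{n,\nu}_{ev}$ denote its even part. Then the following hold. (1) $\alpha^{n,\nu}_{ev}(1)=1$ and $\|A_{\alpha^{n,\nu}_{ev}}\|_2=\max_{z\in\mathbb{T}}|\alpha^{n,\nu}_{ev}(z)|=1$. (2) The inverse $\gamma=(\alpha^{n,\nu}_{ev})^{-1}$ exists, and $\gamma(1)=1$. (3) The $l_2$-norm of $A_\gamma$ is given by $$\|A_\gamma\|_2=\frac{2^{\lfloor\frac{n-1}{2}\rfloor+\nu}}{\sum_{j=0}^{\nu}\binom{n/2+\nu}{j}} .$$ (4) The elements of $\gamma$ decay exponentially, i.e. there exist constants $C>0$ and $\lambda\in(0,1)$ with $|\gamma_\ell|\le C\lambda^{|\ell|}$ for all $\ell\in\mathbb{Z}$.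
   Context: Sequences are real-valued and indexed by $\mathbb{Z}$. The symbol of a sequence $c$ is $c(z):=\sum_{k\in\mathbb{Z}}c_kz^k$, and a Laurent polynomial symbol determines its finitely supported sequence of coefficients. The even part of $\alpha$ is $(\alpha_{ev})_k:=\alpha_{2k}$, with symbol $\alpha_{ev}(z)$. $\mathbb{T}:=\{z\in\mathbb{C}:|z|=1\}$. The inverse of $\beta\in l_1(\mathbb{Z})$ is the sequence $\gamma=\beta^{-1}\in l_1(\mathbb{Z})$ (if it exists) with $\gamma(z)\beta(z)=1$ for all $z\in\mathbb{T}$. For $\beta\in l_1(\mathbb{Z})$, $A_\beta:=(\beta_{j-k})_{j,k\in\mathbb{Z}}$ is the bi-infinite Toeplitz matrix, regarded as a bounded operator on $l_2(\mathbb{Z})$, and $\|A_\beta\|_2:=\sup_{\|c\|_2=1}\|A_\beta c\|_2$ is its operator norm. Binomial coefficients with real upper entry are generalized: $\binom{a}{j}=\frac{a(a-1)\cdots(a-j+1)}{j!}$, $\binom{a}{0}=1$. *)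

theory Defs
  imports "HOL-Analysis.Analysis" "HOL-Computational_Algebra.Polynomial"
begin

definition symbol :: "(int \<Rightarrow> real) \<Rightarrow> complex \<Rightarrow> complex" where
  "symbol c z = (\<Sum>\<^sub>\<infinity>k. of_real (c k) * z powi k)"

definition l1 :: "(int \<Rightarrow> real) set" where
  "l1 = {c. (\<lambda>k. \<bar>c k\<bar>) summable_on UNIV}"

definition l2 :: "(int \<Rightarrow> real) set" where
  "l2 = {c. (\<lambda>k. (c k)\<^sup>2) summable_on UNIV}"

definition l2_norm :: "(int \<Rightarrow> real) \<Rightarrow> real" where
  "l2_norm c = sqrt (\<Sum>\<^sub>\<infinity>k. (c k)\<^sup>2)"

definition toeplitz :: "(int \<Rightarrow> real) \<Rightarrow> int \<Rightarrow> int \<Rightarrow> real" where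
  "toeplitz b j k = b (j - k)"

definition mat_apply :: "(int \<Rightarrow> int \<Rightarrow> real) \<Rightarrow> (int \<Rightarrow> real) \<Rightarrow> int \<Rightarrow> real" where
  "mat_apply A c j = (\<Sum>\<^sub>\<infinity>k. A j k * c k)"

text \<open>A real supremum, hence meaningful only for matrices that act boundedly on \<open>l2\<close>.
  By Young's inequality this includes every \<open>toeplitz b\<close> with \<open>b \<in> l1\<close>; for these the sums
  in \<open>mat_apply\<close> and \<open>l2_norm\<close> converge as well.\<close>

definition op_norm2 :: "(int \<Rightarrow> int \<Rightarrow> real) \<Rightarrow> real" where
  "op_norm2 A = (SUP c\<in>{c \<in> l2. l2_norm c = 1}. l2_norm (mat_apply A c))"

definition is_l1_inverse :: "(int \<Rightarrow> real) \<Rightarrow> (int \<Rightarrow> real) \<Rightarrow> bool" where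
  "is_l1_inverse b g \<longleftrightarrow>
     b \<in> l1 \<and> g \<in> l1 \<and> (\<forall>z. cmod z = 1 \<longrightarrow> symbol g z * symbol b z = 1)"

definition even_part :: "(int \<Rightarrow> real) \<Rightarrow> int \<Rightarrow> real" where
  "even_part a k = a (2 * k)"

definition has_laurent_symbol :: "(int \<Rightarrow> real) \<Rightarrow> (complex \<Rightarrow> complex) \<Rightarrow> bool" where
  "has_laurent_symbol a f \<longleftrightarrow> finite {k. a k \<noteq> 0} \<and> (\<forall>z. z \<noteq> 0 \<longrightarrow> symbol a z = f z)"

definition pseudo_spline_symbol :: "nat \<Rightarrow> nat \<Rightarrow> complex \<Rightarrow> complex" where
  "pseudo_spline_symbol n \<nu> z =
     z powi (- int (n div 2)) * (1 + z) ^ n / 2 ^ (n - 1) *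
     (\<Sum>j=0..\<nu>. of_real ((real n / 2 + real j - 1) gchoose j) *
        (1 / 2 - (z + inverse z) / 4) ^ j)"

definition pseudo_spline_mask :: "nat \<Rightarrow> nat \<Rightarrow> int \<Rightarrow> real" where
  "pseudo_spline_mask n \<nu> = (THE a. has_laurent_symbol a (pseudo_spline_symbol n \<nu>))"

text \<open>The description defining \<open>pseudo_spline_mask\<close> is proper: a Laurent polynomial symbol
  determines its coefficients, and the symbol at hand is a Laurent polynomial with real
  coefficients.\<close>

lemma symbol_eq_sum:
  assumes "finite S" "{k. a k \<noteq> 0} \<subseteq> S"
  shows "symbol a z = (\<Sum>k\<in>S. of_real (a k) * z powi k)"
proof -
  have "symbol a z = (\<Sum>\<^sub>\<infinity>k\<in>S. of_real (a k) * z powi k)"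
    unfolding symbol_def using assms(2) by (intro infsum_cong_neutral) auto
  then show ?thesis using assms(1) by simp
qed

lemma has_laurent_symbol_unique:
  assumes "has_laurent_symbol a f" "has_laurent_symbol b f"
  shows "a = b"
proof (rule ccontr)
  assume "a \<noteq> b"
  define S where "S = {k. a k \<noteq> 0} \<union> {k. b k \<noteq> 0}"
  define d where "d k = a k - b k" for k
  have fin: "finite S" using assms by (auto simp: S_def has_laurent_symbol_def)
  have zero: "(\<Sum>k\<in>S. of_real (d k) * z powi k) = 0" if "z \<noteq> 0" for z :: complex
  proof -
    have "symbol a z = (\<Sum>k\<in>S. of_real (a k) * z powi k)"
      by (rule symbol_eq_sum[OF fin]) (auto simp: S_def)
    moreover have "symbol b z = (\<Sum>k\<in>S. of_real (b k) * z powi k)"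
      by (rule symbol_eq_sum[OF fin]) (auto simp: S_def)
    moreover have "symbol a z = symbol b z"
      using assms that by (simp add: has_laurent_symbol_def)
    ultimately show ?thesis by (simp add: d_def left_diff_distrib sum_subtractf)
  qed
  obtain k0 where k0: "d k0 \<noteq> 0" using \<open>a \<noteq> b\<close> by (auto simp: d_def fun_eq_iff)
  have k0S: "k0 \<in> S" using k0 by (auto simp: S_def d_def)
  define m where "m = Min S"
  have m: "m \<le> k" if "k \<in> S" for k using that fin by (simp add: m_def)
  define p :: "complex poly" where "p = (\<Sum>k\<in>S. monom (of_real (d k)) (nat (k - m)))"
  have "coeff p (nat (k0 - m)) = (\<Sum>k\<in>S. if k = k0 then of_real (d k) else 0)"
    unfolding p_def coeff_sum using m k0S by (intro sum.cong) (auto simp: nat_eq_iff2)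
  then have "coeff p (nat (k0 - m)) = of_real (d k0)" using fin k0S by simp
  then have "p \<noteq> 0" using k0 by auto
  have "poly p z = 0" if "z \<noteq> 0" for z
  proof -
    have "poly p z = (\<Sum>k\<in>S. z powi (- m) * (of_real (d k) * z powi k))"
      unfolding p_def poly_sum poly_monom
    proof (intro sum.cong refl)
      fix k assume "k \<in> S"
      then have "z ^ nat (k - m) = z powi (- m + k)"
        using m[of k] by (simp add: power_int_def)
      also have "\<dots> = z powi (- m) * z powi k" using that by (intro power_int_add) auto
      finally show "of_real (d k) * z ^ nat (k - m) = z powi (- m) * (of_real (d k) * z powi k)"
        by simp
    qed
    also have "\<dots> = 0" using zero[OF that] by (simp flip: sum_distrib_left)
    finally show ?thesis .
  qed
  then have "UNIV - {0} \<subseteq> {z. poly p z = 0}" by auto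
  then have "finite (UNIV - {0 :: complex})"
    using poly_roots_finite[OF \<open>p \<noteq> 0\<close>] finite_subset by blast
  then show False by (simp add: infinite_UNIV_char_0)
qed

lemma laurent_zero: "\<exists>a. has_laurent_symbol a (\<lambda>z. 0)"
  by (rule exI[of _ "\<lambda>_. 0"]) (simp add: has_laurent_symbol_def symbol_def)

lemma laurent_add:
  assumes "\<exists>a. has_laurent_symbol a f" "\<exists>a. has_laurent_symbol a g"
  shows "\<exists>a. has_laurent_symbol a (\<lambda>z. f z + g z)"
proof -
  obtain a b where ab: "has_laurent_symbol a f" "has_laurent_symbol b g" using assms by blast
  define S where "S = {k. a k \<noteq> 0} \<union> {k. b k \<noteq> 0}"
  have fin: "finite S" using ab by (auto simp: S_def has_laurent_symbol_def)
  have "symbol (\<lambda>k. a k + b k) z = symbol a z + symbol b z" for z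
  proof -
    have "symbol a z = (\<Sum>k\<in>S. of_real (a k) * z powi k)"
      by (rule symbol_eq_sum[OF fin]) (auto simp: S_def)
    moreover have "symbol b z = (\<Sum>k\<in>S. of_real (b k) * z powi k)"
      by (rule symbol_eq_sum[OF fin]) (auto simp: S_def)
    moreover have "symbol (\<lambda>k. a k + b k) z = (\<Sum>k\<in>S. of_real (a k + b k) * z powi k)"
      by (rule symbol_eq_sum[OF fin]) (auto simp: S_def)
    ultimately show ?thesis by (simp add: distrib_right sum.distrib)
  qed
  moreover have "finite {k. a k + b k \<noteq> 0}"
    by (rule finite_subset[OF _ fin]) (auto simp: S_def)
  ultimately have "has_laurent_symbol (\<lambda>k. a k + b k) (\<lambda>z. f z + g z)"
    using ab by (simp add: has_laurent_symbol_def)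
  then show ?thesis by blast
qed

lemma laurent_monom_mult:
  assumes "\<exists>a. has_laurent_symbol a f"
  shows "\<exists>a. has_laurent_symbol a (\<lambda>z. of_real r * z powi m * f z)"
proof -
  obtain a where a: "has_laurent_symbol a f" using assms by blast
  define S where "S = {k. a k \<noteq> 0}"
  have fin: "finite S" using a by (auto simp: S_def has_laurent_symbol_def)
  let ?b = "\<lambda>k. r * a (k - m)"
  have sub: "{k. ?b k \<noteq> 0} \<subseteq> (\<lambda>k. k + m) ` S"
  proof
    fix k assume "k \<in> {k. ?b k \<noteq> 0}"
    then have "k - m \<in> S" by (simp add: S_def)
    then show "k \<in> (\<lambda>k. k + m) ` S" by (intro image_eqI[of _ _ "k - m"]) auto
  qed
  have "symbol ?b z = of_real r * z powi m * symbol a z" if "z \<noteq> 0" for z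
  proof -
    have "symbol ?b z = (\<Sum>k\<in>(\<lambda>k. k + m) ` S. of_real (?b k) * z powi k)"
      by (rule symbol_eq_sum) (use fin sub in auto)
    also have "\<dots> = (\<Sum>k\<in>S. of_real (?b (k + m)) * z powi (k + m))"
      by (subst sum.reindex) (auto simp: inj_on_def)
    also have "\<dots> = (\<Sum>k\<in>S. of_real r * z powi m * (of_real (a k) * z powi k))"
      using that by (intro sum.cong) (auto simp: power_int_add)
    also have "\<dots> = of_real r * z powi m * symbol a z"
      by (subst symbol_eq_sum[OF fin]) (auto simp: S_def sum_distrib_left)
    finally show ?thesis .
  qed
  moreover have "finite {k. ?b k \<noteq> 0}" using fin sub finite_subset by blast
  ultimately have "has_laurent_symbol ?b (\<lambda>z. of_real r * z powi m * f z)"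
    using a by (simp add: has_laurent_symbol_def)
  then show ?thesis by blast
qed

lemma laurent_sum:
  assumes "finite I" "\<And>i. i \<in> I \<Longrightarrow> \<exists>a. has_laurent_symbol a (f i)"
  shows "\<exists>a. has_laurent_symbol a (\<lambda>z. \<Sum>i\<in>I. f i z)"
  using assms by (induction I rule: finite_induct) (auto intro: laurent_zero laurent_add)

lemma laurent_cong:
  assumes "\<exists>a. has_laurent_symbol a f" "\<And>z. z \<noteq> 0 \<Longrightarrow> f z = g z"
  shows "\<exists>a. has_laurent_symbol a g"
  using assms by (auto simp: has_laurent_symbol_def)

lemma laurent_mult:
  assumes "\<exists>a. has_laurent_symbol a f" "\<exists>a. has_laurent_symbol a g"
  shows "\<exists>a. has_laurent_symbol a (\<lambda>z. f z * g z)"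
proof -
  obtain a where a: "has_laurent_symbol a f" using assms by blast
  define S where "S = {k. a k \<noteq> 0}"
  have fin: "finite S" using a by (auto simp: S_def has_laurent_symbol_def)
  have "\<exists>c. has_laurent_symbol c (\<lambda>z. \<Sum>k\<in>S. of_real (a k) * z powi k * g z)"
    by (intro laurent_sum fin laurent_monom_mult assms)
  then show ?thesis
  proof (rule laurent_cong)
    fix z :: complex assume "z \<noteq> 0"
    then have "f z = symbol a z" using a by (simp add: has_laurent_symbol_def)
    also have "\<dots> = (\<Sum>k\<in>S. of_real (a k) * z powi k)"
      by (rule symbol_eq_sum[OF fin]) (auto simp: S_def)
    finally show "(\<Sum>k\<in>S. of_real (a k) * z powi k * g z) = f z * g z"
      by (simp add: sum_distrib_right)
  qed
qed

lemma laurent_one: "\<exists>a. has_laurent_symbol a (\<lambda>z. 1)"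
proof -
  let ?a = "\<lambda>k::int. if k = 0 then 1 else 0 :: real"
  have "symbol ?a z = (\<Sum>k\<in>{0}. of_real (?a k) * z powi k)" for z
    by (rule symbol_eq_sum) auto
  then have "has_laurent_symbol ?a (\<lambda>z. 1)" by (simp add: has_laurent_symbol_def)
  then show ?thesis by blast
qed

lemma laurent_monom: "\<exists>a. has_laurent_symbol a (\<lambda>z. of_real r * z powi m)"
  using laurent_monom_mult[OF laurent_one] by simp

lemma laurent_power:
  assumes "\<exists>a. has_laurent_symbol a f"
  shows "\<exists>a. has_laurent_symbol a (\<lambda>z. f z ^ j)"
  by (induction j) (auto intro: laurent_one laurent_mult assms)

lemma pseudo_spline_symbol_laurent:
  "\<exists>a. has_laurent_symbol a (pseudo_spline_symbol n \<nu>)"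
proof -
  let ?t = "\<lambda>z::complex. of_real (1 / 2) * z powi 0 +
    (of_real (- (1 / 4)) * z powi 1 + of_real (- (1 / 4)) * z powi (- 1))"
  let ?b = "\<lambda>z::complex. of_real 1 * z powi 0 + of_real 1 * z powi 1"
  let ?g = "\<lambda>j. (real n / 2 + real j - 1) gchoose j"
  have "\<exists>a. has_laurent_symbol a (\<lambda>z.
     (of_real (1 / 2 ^ (n - 1)) * z powi (- int (n div 2)) * ?b z ^ n) *
     (\<Sum>j=0..\<nu>. of_real (?g j) * z powi 0 * ?t z ^ j))"
    by (intro laurent_mult laurent_monom_mult laurent_sum laurent_power laurent_add laurent_monom)
       auto
  then show ?thesis
  proof (rule laurent_cong)
    fix z :: complex assume "z \<noteq> 0"
    have "?t z = 1 / 2 - (z + inverse z) / 4"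
      by (simp add: power_int_minus field_simps)
    then show "(of_real (1 / 2 ^ (n - 1)) * z powi (- int (n div 2)) * ?b z ^ n) *
       (\<Sum>j=0..\<nu>. of_real (?g j) * z powi 0 * ?t z ^ j) = pseudo_spline_symbol n \<nu> z"
      by (simp add: pseudo_spline_symbol_def)
  qed
qed

lemma has_laurent_symbol_pseudo_spline_mask:
  "has_laurent_symbol (pseudo_spline_mask n \<nu>) (pseudo_spline_symbol n \<nu>)"
proof -
  have "\<exists>!a. has_laurent_symbol a (pseudo_spline_symbol n \<nu>)"
    using pseudo_spline_symbol_laurent has_laurent_symbol_unique by blast
  then show ?thesis unfolding pseudo_spline_mask_def by (rule theI')
qed

end

theory Submission
  imports Defs
begin

text \<open>
  Write \<open>e = n mod 2\<close>, \<open>m = n div 2\<close> and, for \<open>z\<close> on the unit circle,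
  \<open>t = sin\<^sup>2(\<theta>/2) = (1 - Re z) / 2\<close>. With \<open>P\<close> the Taylor polynomial of degree \<open>\<nu>\<close> of
  \<open>(1 - t) powr (- n / 2)\<close> at \<open>0\<close>, the mask symbol is \<open>2 (1 - t)\<^sup>m P(t) ((1 + z) / 2)\<^sup>e\<close>, and
  the symbol of the even part at \<open>z\<^sup>2\<close> is the mean of the values of the mask symbol at \<open>z\<close> and
  \<open>- z\<close>; passing from \<open>z\<close> to \<open>- z\<close> exchanges \<open>t\<close> and \<open>1 - t\<close>. Hence the modulus of the even part
  (its square, when \<open>n\<close> is odd) has the form \<open>F(t) + F(1 - t)\<close> with \<open>F = (1 - t)\<^sup>m P\<close>
  (respectively \<open>F = (1 - t)\<^sup>n P\<^sup>2\<close>).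

  Truncating the binomial series leaves the single defect term in
  \<open>(1 - t) P' = (n / 2) P - const t\<^sup>\<nu>\<close> (\<open>binomial_truncation_ode\<close>), so \<open>F'\<close> is explicit, and
  \<open>F(t) + F(1 - t)\<close> is nonincreasing for \<open>0 \<le> t \<le> 1/2\<close> (\<open>symmetrized_bounds\<close>). So the modulus of the
  symbol of the even part has its maximum \<open>1\<close> at the point \<open>1\<close> and its minimum, where \<open>t = 1/2\<close>,
  at the point \<open>- 1\<close>. A binomial identity evaluates the minimum
  (\<open>even_part_pseudo_spline_modulus\<close>).

  The operator norms follow from one principle (\<open>op_norm2_toeplitz_peak\<close>): if the modulus of an
  absolutely summable symbol is largest at \<open>w = 1\<close> or \<open>w = - 1\<close>, that largest value is the norm of
  the Toeplitz operator. The upper bound rests on Parseval's identity, here with averages over roots of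
  unity in place of integrals; the lower bound comes from the real test vectors \<open>w\<^sup>k\<close> cut off to
  long windows. It is applied to the even part with \<open>w = 1\<close>, and to the inverse with \<open>w = - 1\<close>.

  The inverse of a Laurent polynomial \<open>a\<close> with \<open>0 < \<mu> \<le> \<bar>a\<bar> \<le> 1\<close> on the circle is the Neumann
  series \<open>cnj a (\<Sum>k. (1 - \<bar>a\<bar>\<^sup>2)\<^sup>k)\<close>. The coefficients of its \<open>k\<close>-th term are at most
  \<open>(1 - \<mu>\<^sup>2)\<^sup>k\<close> and vanish outside a band of width proportional to \<open>k\<close>, which gives both convergence
  and exponential decay (\<open>banded_inverse_exponential_decay\<close>). By \<open>l1_symbol_unique\<close> there is no
  other inverse.
\<close>

section \<open>Infinite sums and symbols\<close>

text \<open>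
  Dominated convergence for counting measure: the dominating series makes the finite partial sums
  converge uniformly in the parameter, so the two limits may be exchanged.
\<close>

lemma tendsto_infsum_dominated:
  fixes f :: "'i \<Rightarrow> 'a \<Rightarrow> 'c::banach"
  assumes h: "h summable_on UNIV"
    and le: "\<And>n k. norm (f n k) \<le> h k"
    and lim: "\<And>k. ((\<lambda>n. f n k) \<longlongrightarrow> g k) F"
  shows "((\<lambda>n. infsum (f n) UNIV) \<longlongrightarrow> infsum g UNIV) F"
proof (cases "F = bot")
  case False
  have "norm (g k) \<le> h k" for k
    by (rule tendsto_upperbound[OF tendsto_norm[OF lim]]) (use False le in auto)
  then have "g summable_on UNIV"
    by (rule abs_summable_summable[OF Infinite_Sum.abs_summable_on_comparison_test'[OF h]])
  then have g: "((\<lambda>X. \<Sum>k\<in>X. g k) \<longlongrightarrow> infsum g UNIV) (finite_subsets_at_top UNIV)"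
    by (rule infsum_tendsto)
  have unif: "uniform_limit UNIV (\<lambda>X n. \<Sum>k\<in>X. f n k) (\<lambda>n. infsum (f n) UNIV)
      (finite_subsets_at_top UNIV)"
    by (rule Weierstrass_m_test_general[OF _ h]) (use le in auto)
  show ?thesis
  proof (rule swap_uniform_limit'[OF _ g unif])
    show "\<forall>\<^sub>F X in finite_subsets_at_top UNIV. ((\<lambda>n. \<Sum>k\<in>X. f n k) \<longlongrightarrow> (\<Sum>k\<in>X. g k)) F"
      by (intro always_eventually allI tendsto_sum lim)
  qed simp_all
qed simp

lemma has_sum_sum:
  fixes f :: "'i \<Rightarrow> 'a \<Rightarrow> 'b::topological_comm_monoid_add"
  assumes "finite I" "\<And>i. i \<in> I \<Longrightarrow> (f i has_sum S i) A"
  shows "((\<lambda>x. \<Sum>i\<in>I. f i x) has_sum (\<Sum>i\<in>I. S i)) A"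
  using assms
proof (induction I rule: finite_induct)
  case empty
  show ?case unfolding sum.empty by (rule has_sum_0) simp
next
  case (insert i I)
  have "((\<lambda>x. f i x + (\<Sum>i\<in>I. f i x)) has_sum S i + (\<Sum>i\<in>I. S i)) A"
    by (intro has_sum_add insert) (use insert.prems in auto)
  then show ?case using insert.hyps by simp
qed

lemma symbol_has_sum:
  assumes "b \<in> l1" "cmod z = 1"
  shows "((\<lambda>k. of_real (b k) * z powi k) has_sum symbol b z) UNIV"
  unfolding symbol_def
proof (rule has_sum_infsum[OF abs_summable_summable])
  show "(\<lambda>k. norm (of_real (b k) * z powi k)) summable_on UNIV"
    using assms by (simp add: l1_def norm_mult norm_power_int)
qed

lemma finite_support_l1:
  assumes "finite S" "\<And>k. k \<notin> S \<Longrightarrow> a k = 0"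
  shows "a \<in> l1"
proof -
  have "finite {k. \<bar>a k\<bar> \<noteq> 0}" by (rule finite_subset[OF _ assms(1)]) (use assms(2) in auto)
  then show ?thesis unfolding l1_def by (auto intro: finite_nonzero_values_imp_summable_on)
qed

lemma cnj_powi_unit_circle:
  assumes "cmod z = 1"
  shows "cnj (z powi k) = z powi (- k)"
proof -
  have "cnj z = inverse z"
    using assms by (simp add: inverse_complex_def complex_eq_iff cmod_def)
  then show ?thesis
    unfolding complex_cnj_power_int by (simp add: power_int_inverse power_int_minus)
qed

section \<open>Averages over roots of unity\<close>

text \<open>
  The discrete counterpart of \<open>1/(2\<pi>) \<integral> f(e\<^sup>i\<^sup>\<theta>) d\<theta>\<close>: only finite sums occur, so it can be
  interchanged with the series defining a symbol without any measure theory.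
\<close>

definition root_avg :: "nat \<Rightarrow> (complex \<Rightarrow> complex) \<Rightarrow> complex" where
  "root_avg N f = (\<Sum>r\<le>N. f (cis (2 * pi * real r / real (Suc N)))) / of_nat (Suc N)"

lemma root_avg_cong:
  assumes "\<And>z. cmod z = 1 \<Longrightarrow> f z = g z"
  shows "root_avg N f = root_avg N g"
  unfolding root_avg_def using assms by simp

lemma root_avg_sum: "root_avg N (\<lambda>z. \<Sum>i\<in>I. f i z) = (\<Sum>i\<in>I. root_avg N (f i))"
  unfolding root_avg_def by (subst sum.swap) (simp add: sum_divide_distrib)

lemma root_avg_mult: "root_avg N (\<lambda>z. c * f z) = c * root_avg N f"
  unfolding root_avg_def by (simp flip: sum_distrib_left)

lemma root_avg_add: "root_avg N (\<lambda>z. f z + g z) = root_avg N f + root_avg N g"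
  unfolding root_avg_def by (simp add: sum.distrib add_divide_distrib)

lemma root_avg_mono:
  assumes "\<And>z. cmod z = 1 \<Longrightarrow> cmod (f z) \<le> Re (g z)"
  shows "cmod (root_avg N f) \<le> Re (root_avg N g)"
proof -
  have "cmod (\<Sum>r\<le>N. f (cis (2 * pi * real r / real (Suc N))))
      \<le> (\<Sum>r\<le>N. Re (g (cis (2 * pi * real r / real (Suc N)))))"
    by (intro sum_norm_le assms) simp
  then show ?thesis
    unfolding root_avg_def norm_divide
    by (simp add: divide_right_mono Re_divide_of_nat del: of_nat_Suc)
qed

lemma root_avg_norm_le:
  assumes "\<And>z. cmod z = 1 \<Longrightarrow> cmod (f z) \<le> M"
  shows "cmod (root_avg N f) \<le> M"
proof -
  have "cmod (root_avg N f) \<le> Re (root_avg N (\<lambda>_. of_real M))"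
    by (rule root_avg_mono) (use assms in simp)
  then show ?thesis by (simp add: root_avg_def del: of_nat_Suc)
qed

lemma root_avg_powi:
  assumes "\<bar>d\<bar> \<le> int N"
  shows "root_avg N (\<lambda>z. z powi d) = (if d = 0 then 1 else 0)"
proof (cases "d = 0")
  case True
  then show ?thesis by (simp add: root_avg_def del: of_nat_Suc)
next
  case False
  define q where "q = cis (2 * pi * real_of_int d / real (Suc N))"
  have summand: "cis (2 * pi * real r / real (Suc N)) powi d = q ^ r" for r
    by (simp add: q_def cis_power_int Complex.DeMoivre mult_ac)
  have "q \<noteq> 1"
  proof
    assume "q = 1"
    then have "cos (2 * pi * real_of_int d / real (Suc N)) = 1"
      by (simp add: q_def complex_eq_iff)
    then obtain i where "2 * pi * real_of_int d / real (Suc N) = real_of_int i * 2 * pi"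
      using cos_one_2pi_int by blast
    then have "2 * pi * real_of_int d = 2 * pi * real_of_int (i * int (Suc N))"
      by (simp add: divide_eq_eq mult_ac del: of_nat_Suc)
    then have "d = i * int (Suc N)"
      by (simp only: mult_cancel_left of_int_eq_iff) simp
    then have "int (Suc N) \<le> \<bar>d\<bar>" using False by (intro zdvd_imp_le) auto
    with assms show False by simp
  qed
  moreover have "q ^ Suc N = 1"
    unfolding q_def Complex.DeMoivre by (simp del: of_nat_Suc)
  ultimately have "(\<Sum>r\<le>N. q ^ r) = 0"
    by (simp add: sum_gp0)
  then show ?thesis using False by (simp add: root_avg_def summand del: of_nat_Suc)
qed

text \<open>
  The average over the roots of unity of order \<open>N + 1\<close> of \<open>z\<^sup>k\<^sup>-\<^sup>i\<close> vanishes as soon as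
  \<open>0 < \<bar>k - i\<bar> \<le> N\<close>, so the aliased coefficients move off to infinity as \<open>N\<close> grows.
\<close>

lemma fourier_coefficient_limit:
  assumes b: "b \<in> l1"
  shows "(\<lambda>N. root_avg N (\<lambda>z. z powi (- i) * symbol b z)) \<longlonglongrightarrow> of_real (b i)"
proof -
  have avg: "root_avg N (\<lambda>z. z powi (- i) * symbol b z)
      = (\<Sum>\<^sub>\<infinity>k. of_real (b k) * root_avg N (\<lambda>z. z powi (k - i)))" for N
  proof -
    let ?u = "\<lambda>r. cis (2 * pi * real r / real (Suc N))"
    have "((\<lambda>k. (\<Sum>r\<le>N. ?u r powi (- i) * (of_real (b k) * ?u r powi k)) / of_nat (Suc N))
        has_sum (\<Sum>r\<le>N. ?u r powi (- i) * symbol b (?u r)) / of_nat (Suc N)) UNIV"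
      unfolding divide_inverse
      by (intro has_sum_cmult_left has_sum_sum has_sum_cmult_right symbol_has_sum b) auto
    also have "(\<lambda>k. (\<Sum>r\<le>N. ?u r powi (- i) * (of_real (b k) * ?u r powi k)) / of_nat (Suc N))
        = (\<lambda>k. of_real (b k) * root_avg N (\<lambda>z. z powi (k - i)))"
      unfolding root_avg_def times_divide_eq_right sum_distrib_left
      by (intro ext arg_cong2[of _ _ _ _ "(/)"] sum.cong refl) (simp add: power_int_diff power_int_minus divide_inverse)
    finally show ?thesis by (simp add: root_avg_def infsumI)
  qed
  have "(\<lambda>N. root_avg N (\<lambda>z. z powi (- i) * symbol b z))
      \<longlonglongrightarrow> (\<Sum>\<^sub>\<infinity>k. of_real (b k) * (if k = i then 1 else 0))"
    unfolding avg
  proof (rule tendsto_infsum_dominated[where h = "\<lambda>k. \<bar>b k\<bar>"])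
    show "(\<lambda>k. \<bar>b k\<bar>) summable_on UNIV" using b by (simp add: l1_def)
    show "norm (of_real (b k) * root_avg N (\<lambda>z. z powi (k - i))) \<le> \<bar>b k\<bar>" for N k
    proof -
      have "cmod (root_avg N (\<lambda>z. z powi (k - i))) \<le> 1"
        by (rule root_avg_norm_le) (simp add: norm_power_int)
      then show ?thesis by (simp add: norm_mult mult_left_le)
    qed
    show "(\<lambda>N. of_real (b k) * root_avg N (\<lambda>z. z powi (k - i)))
        \<longlonglongrightarrow> of_real (b k) * (if k = i then 1 else 0)" for k
    proof (intro tendsto_mult_left tendsto_eventually eventually_sequentiallyI[of "nat \<bar>k - i\<bar>"])
      fix N assume "nat \<bar>k - i\<bar> \<le> N"
      then show "root_avg N (\<lambda>z. z powi (k - i)) = (if k = i then 1 else 0)"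
        by (subst root_avg_powi) auto
    qed
  qed
  also have "(\<Sum>\<^sub>\<infinity>k. complex_of_real (b k) * (if k = i then 1 else 0))
      = (\<Sum>\<^sub>\<infinity>k\<in>{i}. of_real (b k))"
    by (rule infsum_cong_neutral) auto
  finally show ?thesis by simp
qed

lemma coefficient_bound:
  assumes b: "b \<in> l1" and M: "\<And>z. cmod z = 1 \<Longrightarrow> cmod (symbol b z) \<le> M"
  shows "\<bar>b i\<bar> \<le> M"
proof -
  have "cmod (root_avg N (\<lambda>z. z powi (- i) * symbol b z)) \<le> M" for N
    by (rule root_avg_norm_le) (use M in \<open>simp add: norm_mult norm_power_int\<close>)
  then have "cmod (of_real (b i)) \<le> M"
    by (intro tendsto_upperbound[OF tendsto_norm[OF fourier_coefficient_limit[OF b]]]) auto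
  then show ?thesis by simp
qed

lemma l1_diff: "b \<in> l1 \<Longrightarrow> c \<in> l1 \<Longrightarrow> (\<lambda>k. b k - c k) \<in> l1"
proof -
  assume "b \<in> l1" "c \<in> l1"
  then have "(\<lambda>k. \<bar>b k\<bar> + \<bar>c k\<bar>) summable_on UNIV" by (simp add: l1_def summable_on_add)
  then have "(\<lambda>k. norm (b k - c k)) summable_on UNIV"
    by (rule Infinite_Sum.abs_summable_on_comparison_test') simp
  then show ?thesis by (simp add: l1_def)
qed

lemma l1_symbol_unique:
  assumes "b \<in> l1" "c \<in> l1" "\<And>z. cmod z = 1 \<Longrightarrow> symbol b z = symbol c z"
  shows "b = c"
proof
  fix i
  have "symbol (\<lambda>k. b k - c k) z = 0" if "cmod z = 1" for z
  proof -
    have "((\<lambda>k. of_real (b k) * z powi k - of_real (c k) * z powi k)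
        has_sum symbol b z - symbol c z) UNIV"
      using has_sum_add[OF symbol_has_sum[OF assms(1) that]
          has_sum_uminusI[OF symbol_has_sum[OF assms(2) that]]] by simp
    then show ?thesis using assms(3)[OF that]
      by (simp add: symbol_def left_diff_distrib infsumI)
  qed
  then have "\<bar>b i - c i\<bar> \<le> 0"
    by (intro coefficient_bound[where b = "\<lambda>k. b k - c k"] l1_diff assms) auto
  then show "b i = c i" by simp
qed

section \<open>Toeplitz operators with absolutely summable symbols\<close>

text \<open>
  Expanding the product of the three symbols reduces the claim to the limit of single Fourier
  coefficients; the right-hand side is the Toeplitz form in \<open>y\<close> and \<open>c\<close>.
\<close>

lemma root_avg_bilinear_limit:
  assumes b: "b \<in> l1"
  shows "(\<lambda>N. root_avg N (\<lambda>z. cnj (\<Sum>j\<in>F. of_real (y j) * z powi j) *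
      (\<Sum>k\<in>G. of_real (c k) * z powi k) * symbol b z))
    \<longlonglongrightarrow> of_real (\<Sum>j\<in>F. \<Sum>k\<in>G. y j * c k * b (j - k))"
proof -
  have "root_avg N (\<lambda>z. cnj (\<Sum>j\<in>F. of_real (y j) * z powi j) *
      (\<Sum>k\<in>G. of_real (c k) * z powi k) * symbol b z)
    = (\<Sum>j\<in>F. \<Sum>k\<in>G. of_real (y j * c k) *
        root_avg N (\<lambda>z. z powi (- (j - k)) * symbol b z))" for N
    unfolding root_avg_mult[symmetric] root_avg_sum[symmetric]
  proof (rule root_avg_cong)
    fix z :: complex assume z: "cmod z = 1"
    then have "z \<noteq> 0" by auto
    have pw: "z powi (- (j - k)) = cnj (z powi j) * z powi k" for j k
      using \<open>z \<noteq> 0\<close> by (simp add: cnj_powi_unit_circle[OF z] flip: power_int_add del: complex_cnj_power_int)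
    then show "cnj (\<Sum>j\<in>F. of_real (y j) * z powi j) *
        (\<Sum>k\<in>G. of_real (c k) * z powi k) * symbol b z
      = (\<Sum>j\<in>F. \<Sum>k\<in>G. of_real (y j * c k) * (z powi (- (j - k)) * symbol b z))"
      unfolding cnj_sum sum_product unfolding sum_distrib_right
      by (intro sum.cong refl) (simp only: pw of_real_mult complex_cnj_mult complex_cnj_complex_of_real mult_ac)
  qed
  moreover have "(\<lambda>N. \<Sum>j\<in>F. \<Sum>k\<in>G. of_real (y j * c k) *
        root_avg N (\<lambda>z. z powi (- (j - k)) * symbol b z))
      \<longlonglongrightarrow> (\<Sum>j\<in>F. \<Sum>k\<in>G. of_real (y j * c k) * of_real (b (j - k)))"
    by (intro tendsto_sum tendsto_mult_left fourier_coefficient_limit b)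
  ultimately show ?thesis by simp
qed

text \<open>
  The Toeplitz form of the unit sequence, whose symbol is \<open>1\<close>, is the inner product.
\<close>

lemma root_avg_parseval_limit:
  assumes fin: "finite F"
  shows "(\<lambda>N. root_avg N (\<lambda>z. of_real ((cmod (\<Sum>j\<in>F. of_real (y j) * z powi j))\<^sup>2)))
    \<longlonglongrightarrow> of_real (\<Sum>j\<in>F. (y j)\<^sup>2)"
proof -
  define \<delta> :: "int \<Rightarrow> real" where "\<delta> k = (if k = 0 then 1 else 0)" for k
  have "\<delta> \<in> l1" by (rule finite_support_l1[of "{0}"]) (auto simp: \<delta>_def)
  have "symbol \<delta> z = 1" for z
    by (subst symbol_eq_sum[of "{0}"]) (auto simp: \<delta>_def)
  have "(\<Sum>j\<in>F. \<Sum>k\<in>F. y j * y k * \<delta> (j - k)) = (\<Sum>j\<in>F. (y j)\<^sup>2)"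
  proof (rule sum.cong)
    fix j assume "j \<in> F"
    have "(\<Sum>k\<in>F. y j * y k * \<delta> (j - k)) = (\<Sum>k\<in>F. if k = j then y j * y k else 0)"
      by (rule sum.cong) (auto simp: \<delta>_def)
    then show "(\<Sum>k\<in>F. y j * y k * \<delta> (j - k)) = (y j)\<^sup>2"
      using \<open>j \<in> F\<close> fin by (simp add: power2_eq_square)
  qed simp
  moreover have "cnj w * w = of_real ((cmod w)\<^sup>2)" for w
    by (metis complex_norm_square mult.commute of_real_power)
  ultimately show ?thesis
    using root_avg_bilinear_limit[OF \<open>\<delta> \<in> l1\<close>, of y F y F]
    by (simp only: \<open>\<And>z. symbol \<delta> z = 1\<close> mult_1_right)
qed

text \<open>
  The form is a limit of averages of \<open>cnj Y \<cdot> C \<cdot> b\<close>, whose modulus is at most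
  \<open>M (\<bar>Y\<bar>\<^sup>2 + \<bar>C\<bar>\<^sup>2) / 2\<close> on the circle. The arithmetic-geometric mean inequality stands in for the
  Cauchy-Schwarz inequality and keeps the bound additive in \<open>y\<close> and \<open>c\<close>.
\<close>

lemma toeplitz_form_bound:
  assumes b: "b \<in> l1" and M: "\<And>z. cmod z = 1 \<Longrightarrow> cmod (symbol b z) \<le> M"
    and fin: "finite F" "finite G"
  shows "(\<Sum>j\<in>F. \<Sum>k\<in>G. y j * c k * b (j - k))
    \<le> M / 2 * ((\<Sum>j\<in>F. (y j)\<^sup>2) + (\<Sum>k\<in>G. (c k)\<^sup>2))"
proof -
  define Y where "Y z = (\<Sum>j\<in>F. of_real (y j) * z powi j)" for z :: complex
  define C where "C z = (\<Sum>k\<in>G. of_real (c k) * z powi k)" for z :: complex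
  let ?R = "\<lambda>N. root_avg N (\<lambda>z. of_real (M / 2) *
      (of_real ((cmod (Y z))\<^sup>2) + of_real ((cmod (C z))\<^sup>2)))"
  have le: "cmod (root_avg N (\<lambda>z. cnj (Y z) * C z * symbol b z)) \<le> Re (?R N)" for N
  proof (rule root_avg_mono)
    fix z :: complex assume z: "cmod z = 1"
    have "2 * (cmod (Y z) * cmod (C z)) \<le> (cmod (Y z))\<^sup>2 + (cmod (C z))\<^sup>2"
      using sum_squares_bound[of "cmod (Y z)" "cmod (C z)"] by simp
    then have "cmod (Y z) * cmod (C z) * cmod (symbol b z)
        \<le> (((cmod (Y z))\<^sup>2 + (cmod (C z))\<^sup>2) / 2) * M"
      using M[OF z] by (intro mult_mono) auto
    then show "cmod (cnj (Y z) * C z * symbol b z) \<le> Re (of_real (M / 2) *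
      (of_real ((cmod (Y z))\<^sup>2) + of_real ((cmod (C z))\<^sup>2)))"
      by (simp add: norm_mult field_simps flip: of_real_add of_real_mult of_real_power)
  qed
  have "(\<lambda>N. Re (?R N)) \<longlonglongrightarrow> Re (of_real (M / 2) *
      (of_real (\<Sum>j\<in>F. (y j)\<^sup>2) + of_real (\<Sum>k\<in>G. (c k)\<^sup>2)))"
    unfolding root_avg_mult root_avg_add Y_def C_def
    by (intro tendsto_Re tendsto_mult_left tendsto_add root_avg_parseval_limit fin)
  moreover have "(\<lambda>N. cmod (root_avg N (\<lambda>z. cnj (Y z) * C z * symbol b z)))
      \<longlonglongrightarrow> cmod (of_real (\<Sum>j\<in>F. \<Sum>k\<in>G. y j * c k * b (j - k)))"
    unfolding Y_def C_def by (intro tendsto_norm root_avg_bilinear_limit b)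
  ultimately have "cmod (of_real (\<Sum>j\<in>F. \<Sum>k\<in>G. y j * c k * b (j - k)))
      \<le> Re (of_real (M / 2) * (of_real (\<Sum>j\<in>F. (y j)\<^sup>2) + of_real (\<Sum>k\<in>G. (c k)\<^sup>2)))"
    using le by (intro LIMSEQ_le) auto
  also have "\<dots> = M / 2 * ((\<Sum>j\<in>F. (y j)\<^sup>2) + (\<Sum>k\<in>G. (c k)\<^sup>2))"
    unfolding of_real_add[symmetric] of_real_mult[symmetric] Re_complex_of_real ..
  finally show ?thesis unfolding norm_of_real by linarith
qed

text \<open>
  The form bound for finite supports passes to the limit in \<open>c\<close>, row by row, and then the part of
  the image vector that lies in a finite window serves as the test vector \<open>y\<close>.
\<close>

lemma toeplitz_l2_bound:
  assumes b: "b \<in> l1" and M: "M > 0" "\<And>z. cmod z = 1 \<Longrightarrow> cmod (symbol b z) \<le> M"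
    and c: "c \<in> l2"
  shows "mat_apply (toeplitz b) c \<in> l2"
    and "l2_norm (mat_apply (toeplitz b) c) \<le> M * l2_norm c"
proof -
  define u where "u = mat_apply (toeplitz b) c"
  define T where "T = (\<Sum>\<^sub>\<infinity>k. (c k)\<^sup>2)"
  have c2: "(\<lambda>k. (c k)\<^sup>2) summable_on UNIV" using c by (simp add: l2_def)
  have part: "(\<Sum>k\<in>G. (c k)\<^sup>2) \<le> T" if "finite G" for G
    unfolding T_def by (rule finite_sum_le_infsum[OF c2 that]) auto
  have "T \<ge> 0" using part[of "{}"] by simp
  have row: "((\<lambda>k. b (j - k) * c k) has_sum u j) UNIV" for j
    unfolding u_def mat_apply_def toeplitz_def
  proof (rule has_sum_infsum[OF abs_summable_summable])
    have "(\<lambda>k. \<bar>b (j - k)\<bar>) summable_on UNIV"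
    proof -
      have "bij_betw (\<lambda>k. j - k) UNIV UNIV"
        by (rule bij_betwI[of _ _ _ "\<lambda>k. j - k"]) auto
      from summable_on_reindex_bij_betw[OF this, of "\<lambda>k. \<bar>b k\<bar>"] b show ?thesis
        by (simp add: l1_def)
    qed
    then have "(\<lambda>k. \<bar>b (j - k)\<bar> * sqrt T) summable_on UNIV" by (rule summable_on_cmult_left)
    moreover have "norm (b (j - k) * c k) \<le> \<bar>b (j - k)\<bar> * sqrt T" for k
      using part[of "{k}"] by (auto simp: abs_mult intro!: mult_left_mono real_le_rsqrt)
    ultimately show "(\<lambda>k. norm (b (j - k) * c k)) summable_on UNIV"
      by (intro Infinite_Sum.abs_summable_on_comparison_test') auto
  qed
  have form: "(\<Sum>j\<in>F. y j * u j) \<le> M / 2 * ((\<Sum>j\<in>F. (y j)\<^sup>2) + T)" if F: "finite F" for F y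
  proof (rule tendsto_upperbound)
    show "((\<lambda>G. \<Sum>j\<in>F. y j * (\<Sum>k\<in>G. b (j - k) * c k)) \<longlongrightarrow> (\<Sum>j\<in>F. y j * u j))
        (finite_subsets_at_top UNIV)"
      using row by (intro tendsto_sum tendsto_mult_left) (simp add: has_sum_def)
    show "\<forall>\<^sub>F G in finite_subsets_at_top UNIV.
        (\<Sum>j\<in>F. y j * (\<Sum>k\<in>G. b (j - k) * c k)) \<le> M / 2 * ((\<Sum>j\<in>F. (y j)\<^sup>2) + T)"
    proof (rule eventually_finite_subsets_at_top_weakI)
      fix G :: "int set" assume G: "finite G"
      have "(\<Sum>j\<in>F. y j * (\<Sum>k\<in>G. b (j - k) * c k))
          = (\<Sum>j\<in>F. \<Sum>k\<in>G. y j * c k * b (j - k))"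
        by (simp add: sum_distrib_left mult_ac)
      also have "\<dots> \<le> M / 2 * ((\<Sum>j\<in>F. (y j)\<^sup>2) + (\<Sum>k\<in>G. (c k)\<^sup>2))"
        by (rule toeplitz_form_bound[OF b M(2) F G])
      also have "\<dots> \<le> M / 2 * ((\<Sum>j\<in>F. (y j)\<^sup>2) + T)"
        using part[OF G] M(1) by (intro mult_left_mono) auto
      finally show "(\<Sum>j\<in>F. y j * (\<Sum>k\<in>G. b (j - k) * c k)) \<le> M / 2 * ((\<Sum>j\<in>F. (y j)\<^sup>2) + T)" .
    qed
  qed simp
  have bound: "(\<Sum>j\<in>F. (u j)\<^sup>2) \<le> M\<^sup>2 * T" if F: "finite F" for F
  proof -
    define s where "s = (\<Sum>j\<in>F. (u j)\<^sup>2)"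
    \<comment> \<open>The weight \<open>1 / M\<close> balances the two halves of the arithmetic-geometric mean bound.\<close>
    have "(\<Sum>j\<in>F. u j / M * u j) = s / M"
      by (simp add: s_def sum_divide_distrib power2_eq_square)
    moreover have "(\<Sum>j\<in>F. (u j / M)\<^sup>2) = s / M\<^sup>2"
      by (simp add: s_def sum_divide_distrib power_divide)
    ultimately have "s / M \<le> M / 2 * (s / M\<^sup>2 + T)"
      using form[OF F, of "\<lambda>j. u j / M"] by simp
    then show ?thesis unfolding s_def[symmetric] using M(1)
      by (simp add: field_simps power2_eq_square)
  qed
  have u2: "(\<lambda>j. (u j)\<^sup>2) summable_on UNIV"
    by (rule nonneg_bdd_above_summable_on) (auto intro!: bdd_aboveI2[where M = "M\<^sup>2 * T"] bound)
  then show "mat_apply (toeplitz b) c \<in> l2" by (simp add: l2_def u_def)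
  have "(\<Sum>\<^sub>\<infinity>j. (u j)\<^sup>2) \<le> M\<^sup>2 * T"
    by (rule infsum_le_finite_sums[OF u2]) (use bound in auto)
  then show "l2_norm (mat_apply (toeplitz b) c) \<le> M * l2_norm c"
    unfolding l2_norm_def u_def[symmetric] T_def[symmetric]
    using M(1) by (intro real_le_lsqrt) (auto simp: power_mult_distrib \<open>T \<ge> 0\<close>)
qed

text \<open>
  The supremum in \<open>op_norm2\<close> is over a bounded set, so it is an upper bound.
\<close>

lemma op_norm2_ge:
  assumes b: "b \<in> l1" and M: "M > 0" "\<And>z. cmod z = 1 \<Longrightarrow> cmod (symbol b z) \<le> M"
    and c: "c \<in> l2" "l2_norm c = 1"
  shows "l2_norm (mat_apply (toeplitz b) c) \<le> op_norm2 (toeplitz b)"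
  unfolding op_norm2_def
proof (rule cSUP_upper)
  show "bdd_above ((\<lambda>c. l2_norm (mat_apply (toeplitz b) c)) ` {c \<in> l2. l2_norm c = 1})"
    using toeplitz_l2_bound(2)[OF b M] by (intro bdd_aboveI2[where M = M]) force
qed (use c in auto)

lemma card_shift_overlap:
  "card {k \<in> {0..int N}. k + l \<in> {0..int N}} = Suc N - nat \<bar>l\<bar>"
proof -
  have "{k \<in> {0..int N}. k + l \<in> {0..int N}} = {max 0 (- l)..min (int N) (int N - l)}" by auto
  then show ?thesis by (auto simp: max_def min_def)
qed

text \<open>
  In the double sum each difference \<open>l = j - k\<close> occurs \<open>N + 1 - \<bar>l\<bar>\<close> times, and
  \<open>w\<^sup>j w\<^sup>k = w\<^sup>j\<^sup>-\<^sup>k\<close> because \<open>w\<^sup>2 = 1\<close>. So the averages are the Fejer means of the series for the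
  symbol at \<open>w\<close>.
\<close>

lemma fejer_window_limit:
  assumes b: "b \<in> l1" and w: "w = 1 \<or> w = (- 1 :: real)"
  shows "(\<lambda>N. (\<Sum>j\<in>{0..int N}. \<Sum>k\<in>{0..int N}. w powi j * w powi k * b (j - k)) / real (Suc N))
    \<longlonglongrightarrow> Re (symbol b (of_real w))"
proof -
  have w_nz: "w \<noteq> 0" and w_abs: "\<bar>w powi l\<bar> = 1" for l
    using w by (auto simp: power_int_abs)
  have w_diff: "w powi j * w powi k = w powi (j - k)" for j k
  proof -
    have "w powi (- k) = inverse w powi k" by (simp add: power_int_minus power_int_inverse)
    also have "inverse w = w" using w by auto
    finally have "w powi k = w powi (- k)" by simp
    then show ?thesis using power_int_add[of w j "- k"] w_nz by simp
  qed
  have bw: "(\<lambda>l. b l * w powi l) summable_on UNIV"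
    by (rule abs_summable_summable) (use b in \<open>simp add: l1_def abs_mult w_abs\<close>)
  let ?W = "\<lambda>N. {0..int N}"
  have avg: "(\<Sum>j\<in>?W N. \<Sum>k\<in>?W N. w powi j * w powi k * b (j - k)) / real (Suc N)
      = (\<Sum>\<^sub>\<infinity>l. b l * w powi l * (real (Suc N - nat \<bar>l\<bar>) / real (Suc N)))" for N
  proof -
    have shift: "((\<lambda>l. if k + l \<in> ?W N then b l * w powi l else 0)
        has_sum (\<Sum>j\<in>?W N. w powi j * w powi k * b (j - k))) UNIV" for k
    proof -
      have "((\<lambda>l. if k + l \<in> ?W N then b l * w powi l else 0)
        has_sum (\<Sum>j\<in>?W N. b (j - k) * w powi (j - k))) UNIV"
      proof (rule has_sum_finite_neutralI[of "(\<lambda>j. j - k) ` ?W N"])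
        show "(\<Sum>j\<in>?W N. b (j - k) * w powi (j - k)) =
          (\<Sum>l\<in>(\<lambda>j. j - k) ` ?W N. if k + l \<in> ?W N then b l * w powi l else 0)"
          by (subst sum.reindex) (auto simp: inj_on_def)
        show "(if k + l \<in> ?W N then b l * w powi l else 0) = 0"
          if "l \<in> UNIV - (\<lambda>j. j - k) ` ?W N" for l
          using that by (force simp: image_iff)
      qed auto
      then show ?thesis by (simp add: w_diff mult.commute)
    qed
    have "((\<lambda>l. (\<Sum>k\<in>?W N. if k + l \<in> ?W N then b l * w powi l else 0) / real (Suc N))
        has_sum (\<Sum>k\<in>?W N. \<Sum>j\<in>?W N. w powi j * w powi k * b (j - k)) / real (Suc N)) UNIV"
      unfolding divide_inverse by (intro has_sum_cmult_left has_sum_sum shift) auto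
    moreover have "(\<Sum>k\<in>?W N. if k + l \<in> ?W N then b l * w powi l else 0)
        = b l * w powi l * real (Suc N - nat \<bar>l\<bar>)" for l
      unfolding card_shift_overlap[symmetric] by (subst sum.inter_filter[symmetric]) auto
    ultimately show ?thesis
      by (subst sum.swap) (simp add: infsumI)
  qed
  have "(\<lambda>N. (\<Sum>j\<in>?W N. \<Sum>k\<in>?W N. w powi j * w powi k * b (j - k)) / real (Suc N))
      \<longlonglongrightarrow> (\<Sum>\<^sub>\<infinity>l. b l * w powi l)"
    unfolding avg
  proof (rule tendsto_infsum_dominated[where h = "\<lambda>l. \<bar>b l\<bar>"])
    show "(\<lambda>l. \<bar>b l\<bar>) summable_on UNIV" using b by (simp add: l1_def)
    show "norm (b l * w powi l * (real (Suc N - nat \<bar>l\<bar>) / real (Suc N))) \<le> \<bar>b l\<bar>" for N l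
    proof -
      have "real (Suc N - nat \<bar>l\<bar>) / real (Suc N) \<le> 1" by (simp add: divide_simps)
      then have "\<bar>b l\<bar> * (real (Suc N - nat \<bar>l\<bar>) / real (Suc N)) \<le> \<bar>b l\<bar>"
        by (rule mult_left_le) simp
      then show ?thesis by (simp add: abs_mult w_abs del: of_nat_Suc)
    qed
    show "(\<lambda>N. b l * w powi l * (real (Suc N - nat \<bar>l\<bar>) / real (Suc N)))
        \<longlonglongrightarrow> b l * w powi l" for l
    proof -
      have "(\<lambda>N. 1 - real (nat \<bar>l\<bar>) * inverse (real (Suc N))) \<longlonglongrightarrow> 1 - real (nat \<bar>l\<bar>) * 0"
        by (intro tendsto_intros LIMSEQ_inverse_real_of_nat)
      moreover have "eventually (\<lambda>N. 1 - real (nat \<bar>l\<bar>) * inverse (real (Suc N))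
          = real (Suc N - nat \<bar>l\<bar>) / real (Suc N)) sequentially"
        by (intro eventually_sequentiallyI[of "nat \<bar>l\<bar>"])
          (simp add: of_nat_diff field_simps del: of_nat_Suc)
      ultimately have "(\<lambda>N. real (Suc N - nat \<bar>l\<bar>) / real (Suc N)) \<longlonglongrightarrow> 1"
        by (simp add: tendsto_cong)
      from tendsto_mult_left[OF this, of "b l * w powi l"] show ?thesis by simp
    qed
  qed
  also have "(\<Sum>\<^sub>\<infinity>l. b l * w powi l) = Re (symbol b (of_real w))"
  proof -
    have "((\<lambda>l. complex_of_real (b l * w powi l)) has_sum of_real (\<Sum>\<^sub>\<infinity>l. b l * w powi l)) UNIV"
      by (intro has_sum_of_real has_sum_infsum bw)
    then have "symbol b (of_real w) = of_real (\<Sum>\<^sub>\<infinity>l. b l * w powi l)"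
      unfolding symbol_def by (intro infsumI) (simp add: of_real_power_int)
    then show ?thesis by simp
  qed
  finally show ?thesis .
qed

lemma symbol_real_point:
  shows "symbol b (of_real w) \<in> \<real>"
proof -
  have "cnj (symbol b (of_real w)) = symbol b (of_real w)"
    unfolding symbol_def infsum_cnj[symmetric] by simp
  then show ?thesis by (simp add: Reals_cnj_iff)
qed

text \<open>
  The windowed sequences \<open>w\<^sup>k\<close> are approximate eigenvectors for the value of the symbol at \<open>w\<close>. A
  real point \<open>w\<close> of the circle is required because sequences are real.
\<close>

theorem op_norm2_toeplitz_peak:
  assumes b: "b \<in> l1" and w: "w = 1 \<or> w = (- 1 :: real)"
    and nz: "symbol b (of_real w) \<noteq> 0"
    and peak: "\<And>z. cmod z = 1 \<Longrightarrow> cmod (symbol b z) \<le> cmod (symbol b (of_real w))"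
  shows "op_norm2 (toeplitz b) = cmod (symbol b (of_real w))"
proof (rule antisym)
  let ?M = "cmod (symbol b (of_real w))"
  have M: "?M > 0" using nz by simp
  define d where "d N k = (if k \<in> {0..int N} then w powi k / sqrt (real (Suc N)) else 0)" for N k
  have w2: "(w powi k)\<^sup>2 = 1" for k
    using w by (auto simp: power2_eq_square simp flip: power_int_mult_distrib)
  have d_sum: "((\<lambda>k. (d N k)\<^sup>2) has_sum 1) UNIV" for N
  proof (rule has_sum_finite_neutralI[of "{0..int N}"])
    show "1 = (\<Sum>k\<in>{0..int N}. (d N k)\<^sup>2)"
      by (simp add: d_def power_divide w2 del: of_nat_Suc)
  qed (auto simp: d_def)
  then have d: "d N \<in> l2" "l2_norm (d N) = 1" for N
    by (auto simp: l2_def l2_norm_def infsumI dest: has_sum_imp_summable)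
  show "op_norm2 (toeplitz b) \<le> ?M"
    unfolding op_norm2_def
  proof (rule cSUP_least)
    show "{c \<in> l2. l2_norm c = 1} \<noteq> {}" using d by blast
    show "l2_norm (mat_apply (toeplitz b) c) \<le> ?M" if "c \<in> {c \<in> l2. l2_norm c = 1}" for c
      using toeplitz_l2_bound(2)[OF b M peak, of c] that by simp
  qed
  have le: "\<bar>(\<Sum>j\<in>{0..int N}. \<Sum>k\<in>{0..int N}. w powi j * w powi k * b (j - k)) / real (Suc N)\<bar>
      \<le> op_norm2 (toeplitz b)" for N
  proof -
    let ?W = "{0..int N}"
    define u where "u = mat_apply (toeplitz b) (d N)"
    have u: "u j = (\<Sum>k\<in>?W. b (j - k) * d N k)" for j
    proof -
      have "u j = (\<Sum>\<^sub>\<infinity>k\<in>?W. b (j - k) * d N k)"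
        unfolding u_def mat_apply_def toeplitz_def by (rule infsum_cong_neutral) (auto simp: d_def)
      then show ?thesis by simp
    qed
    have "u \<in> l2" unfolding u_def by (rule toeplitz_l2_bound(1)[OF b M peak d(1)])
    have "(\<Sum>j\<in>?W. \<Sum>k\<in>?W. w powi j * w powi k * b (j - k)) / real (Suc N)
        = (\<Sum>j\<in>?W. d N j * u j)"
      unfolding u sum_distrib_left sum_divide_distrib
      by (intro sum.cong refl) (simp add: d_def del: of_nat_Suc)
    moreover have "(\<Sum>j\<in>?W. d N j * u j)\<^sup>2 \<le> (\<Sum>j\<in>?W. (d N j)\<^sup>2) * (\<Sum>j\<in>?W. (u j)\<^sup>2)"
      by (rule Cauchy_Schwarz_ineq_sum)
    moreover have "(\<Sum>j\<in>?W. (d N j)\<^sup>2) = 1"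
      by (simp add: d_def power_divide w2 del: of_nat_Suc)
    moreover have "(\<Sum>j\<in>?W. (u j)\<^sup>2) \<le> (\<Sum>\<^sub>\<infinity>j. (u j)\<^sup>2)"
      using \<open>u \<in> l2\<close> by (intro finite_sum_le_infsum) (auto simp: l2_def)
    ultimately have "((\<Sum>j\<in>?W. \<Sum>k\<in>?W. w powi j * w powi k * b (j - k)) / real (Suc N))\<^sup>2
        \<le> (\<Sum>\<^sub>\<infinity>j. (u j)\<^sup>2)" by simp
    then have "\<bar>(\<Sum>j\<in>?W. \<Sum>k\<in>?W. w powi j * w powi k * b (j - k)) / real (Suc N)\<bar> \<le> l2_norm u"
      unfolding l2_norm_def by (intro real_le_rsqrt) (simp only: power2_abs)
    also have "\<dots> \<le> op_norm2 (toeplitz b)"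
      unfolding u_def by (rule op_norm2_ge[OF b M peak d])
    finally show ?thesis .
  qed
  have "\<bar>Re (symbol b (of_real w))\<bar> \<le> op_norm2 (toeplitz b)"
    by (rule tendsto_upperbound[OF tendsto_rabs[OF fejer_window_limit[OF b w]]])
      (intro always_eventually allI le, simp)
  moreover have "\<bar>Re (symbol b (of_real w))\<bar> = ?M"
    using symbol_real_point[of b w] by (auto elim!: Reals_cases)
  ultimately show "?M \<le> op_norm2 (toeplitz b)" by simp
qed

section \<open>Inverting Laurent polynomials on the unit circle\<close>

text \<open>
  Tracks the degree of a Laurent polynomial: the link between the number of factors in a Neumann term
  and the position of its coefficients is what produces exponential decay.
\<close>

definition banded :: "nat \<Rightarrow> (int \<Rightarrow> real) \<Rightarrow> bool" where
  "banded K c \<longleftrightarrow> (\<forall>l. c l \<noteq> 0 \<longrightarrow> \<bar>l\<bar> \<le> int K)"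

lemma finite_support_banded:
  assumes "finite {k. a k \<noteq> 0}"
  shows "\<exists>K. banded K a"
proof -
  define K where "K = nat (Max (insert 0 (abs ` {k. a k \<noteq> 0})))"
  have "\<bar>l\<bar> \<le> int K" if "a l \<noteq> 0" for l
  proof -
    have "\<bar>l\<bar> \<le> Max (insert 0 (abs ` {k. a k \<noteq> 0}))"
      using assms that by (intro Max_ge) auto
    then show ?thesis unfolding K_def by linarith
  qed
  then show ?thesis by (auto simp: banded_def)
qed

lemma banded_symbol:
  assumes "banded K c" "K \<le> L"
  shows "symbol c z = (\<Sum>l\<in>{- int L..int L}. of_real (c l) * z powi l)"
proof (rule symbol_eq_sum)
  show "{l. c l \<noteq> 0} \<subseteq> {- int L..int L}"
  proof
    fix l assume "l \<in> {l. c l \<noteq> 0}"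
    then have "\<bar>l\<bar> \<le> int K" using assms(1) by (simp add: banded_def)
    then show "l \<in> {- int L..int L}" using assms(2) by auto
  qed
qed simp

lemma banded_l1:
  assumes "banded K c"
  shows "c \<in> l1"
proof (rule finite_support_l1[of "{- int K..int K}"])
  show "c k = 0" if "k \<notin> {- int K..int K}" for k
    using assms that unfolding banded_def by (cases "c k = 0") auto
qed simp

lemma symbol_shift:
  assumes "z \<noteq> 0"
  shows "symbol (\<lambda>l. d (l - i)) z = z powi i * symbol d z"
proof -
  have "bij_betw (\<lambda>l. l + i) UNIV (UNIV :: int set)"
    by (rule bij_betwI[of _ _ _ "\<lambda>l. l - i"]) auto
  then have "symbol (\<lambda>l. d (l - i)) z = (\<Sum>\<^sub>\<infinity>l. of_real (d l) * z powi (l + i))"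
    unfolding symbol_def by (subst infsum_reindex_bij_betw[symmetric]) auto
  also have "\<dots> = (\<Sum>\<^sub>\<infinity>l. z powi i * (of_real (d l) * z powi l))"
    using assms by (simp add: power_int_add mult_ac)
  also have "\<dots> = z powi i * symbol d z"
    unfolding symbol_def by (rule infsum_cmult_right')
  finally show ?thesis .
qed

lemma banded_mult:
  assumes c: "banded K c" and d: "banded L d"
  shows "\<exists>e. banded (K + L) e \<and> (\<forall>z. z \<noteq> 0 \<longrightarrow> symbol e z = symbol c z * symbol d z)"
proof (intro exI conjI allI impI)
  let ?e = "\<lambda>l. \<Sum>i\<in>{- int K..int K}. c i * d (l - i)"
  have shifted: "banded (K + L) (\<lambda>l. d (l - i))" if "i \<in> {- int K..int K}" for i
    unfolding banded_def
  proof (intro allI impI)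
    fix l assume "d (l - i) \<noteq> 0"
    with d have "\<bar>l - i\<bar> \<le> int L" by (simp add: banded_def)
    with that show "\<bar>l\<bar> \<le> int (K + L)" by auto
  qed
  show e: "banded (K + L) ?e"
    unfolding banded_def
  proof (intro allI impI)
    fix l assume "?e l \<noteq> 0"
    then obtain i where i: "i \<in> {- int K..int K}" "c i * d (l - i) \<noteq> 0"
      by (rule sum.not_neutral_contains_not_neutral)
    with shifted[OF i(1)] show "\<bar>l\<bar> \<le> int (K + L)" by (simp add: banded_def)
  qed
  fix z :: complex assume z: "z \<noteq> 0"
  have "symbol ?e z = (\<Sum>l\<in>{- int (K + L)..int (K + L)}. \<Sum>i\<in>{- int K..int K}.
      of_real (c i) * (of_real (d (l - i)) * z powi l))"
    unfolding banded_symbol[OF e order_refl] by (simp add: sum_distrib_right mult.assoc)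
  also have "\<dots> = (\<Sum>i\<in>{- int K..int K}. of_real (c i) * symbol (\<lambda>l. d (l - i)) z)"
    by (subst sum.swap) (simp add: banded_symbol[OF shifted order_refl] sum_distrib_left)
  also have "\<dots> = symbol c z * symbol d z"
    by (simp add: symbol_shift[OF z] banded_symbol[OF c order_refl] sum_distrib_right mult.assoc)
  finally show "symbol ?e z = symbol c z * symbol d z" .
qed

lemma banded_reflect:
  assumes "banded K a"
  shows "banded K (\<lambda>l. a (- l))" "cmod z = 1 \<Longrightarrow> symbol (\<lambda>l. a (- l)) z = cnj (symbol a z)"
proof -
  show "banded K (\<lambda>l. a (- l))"
    using assms unfolding banded_def by (metis abs_minus_cancel)
  assume z: "cmod z = 1"
  have "bij_betw uminus UNIV (UNIV :: int set)"
    by (rule bij_betwI[of _ _ _ uminus]) auto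
  then have "symbol (\<lambda>l. a (- l)) z = (\<Sum>\<^sub>\<infinity>l. of_real (a l) * z powi (- l))"
    unfolding symbol_def by (subst infsum_reindex_bij_betw[symmetric]) auto
  also have "\<dots> = cnj (symbol a z)"
    unfolding symbol_def infsum_cnj[symmetric] by (simp add: cnj_powi_unit_circle[OF z] del: complex_cnj_power_int)
  finally show "symbol (\<lambda>l. a (- l)) z = cnj (symbol a z)" .
qed

text \<open>
  Each step multiplies by \<open>1 - a(z) a(1/z)\<close>, which widens the band by \<open>2 K\<close>.
\<close>

lemma banded_neumann_term:
  assumes a: "banded K a"
  shows "\<exists>e. banded (K + k * (2 * K)) e \<and>
    (\<forall>z. cmod z = 1 \<longrightarrow> symbol e z = cnj (symbol a z) * (1 - of_real ((cmod (symbol a z))\<^sup>2)) ^ k)"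
proof (induction k)
  case 0
  show ?case using banded_reflect[OF a] by (intro exI[of _ "\<lambda>l. a (- l)"]) simp
next
  case (Suc k)
  then obtain e where e: "banded (K + k * (2 * K)) e"
    "\<And>z. cmod z = 1 \<Longrightarrow> symbol e z = cnj (symbol a z) * (1 - of_real ((cmod (symbol a z))\<^sup>2)) ^ k"
    by blast
  obtain b where b: "banded (K + K) b"
    "\<And>z. z \<noteq> 0 \<Longrightarrow> symbol b z = symbol a z * symbol (\<lambda>l. a (- l)) z"
    using banded_mult[OF a banded_reflect(1)[OF a]] by blast
  obtain f where f: "banded (K + K + (K + k * (2 * K))) f"
    "\<And>z. z \<noteq> 0 \<Longrightarrow> symbol f z = symbol b z * symbol e z"
    using banded_mult[OF b(1) e(1)] by blast
  have fe: "banded (K + Suc k * (2 * K)) (\<lambda>l. e l - f l)"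
    unfolding banded_def
  proof (intro allI impI)
    fix l assume "e l - f l \<noteq> 0"
    then have "e l \<noteq> 0 \<or> f l \<noteq> 0" by auto
    moreover have "\<bar>l\<bar> \<le> int (K + k * (2 * K))" if "e l \<noteq> 0"
      using e(1) that by (simp add: banded_def)
    moreover have "\<bar>l\<bar> \<le> int (K + K + (K + k * (2 * K)))" if "f l \<noteq> 0"
      using f(1) that by (simp add: banded_def)
    ultimately show "\<bar>l\<bar> \<le> int (K + Suc k * (2 * K))" by fastforce
  qed
  have "symbol (\<lambda>l. e l - f l) z =
      cnj (symbol a z) * (1 - of_real ((cmod (symbol a z))\<^sup>2)) ^ Suc k" if z: "cmod z = 1" for z
  proof -
    have "z \<noteq> 0" using z by auto
    have "symbol (\<lambda>l. e l - f l) z = symbol e z - symbol f z"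
      using banded_symbol[OF fe order_refl, of z] banded_symbol[OF e(1), of "K + Suc k * (2 * K)" z]
        banded_symbol[OF f(1), of "K + Suc k * (2 * K)" z]
      by (simp add: sum_subtractf left_diff_distrib)
    also have "\<dots> = symbol e z * (1 - symbol a z * cnj (symbol a z))"
      by (simp add: f(2) b(2) \<open>z \<noteq> 0\<close> banded_reflect(2)[OF a z] algebra_simps)
    also have "symbol a z * cnj (symbol a z) = of_real ((cmod (symbol a z))\<^sup>2)"
      by (metis complex_norm_square of_real_power)
    finally show ?thesis by (simp add: e(2)[OF z])
  qed
  with fe show ?case by blast
qed

lemma geometric_int_summable:
  fixes r :: real
  assumes "0 < r" "r < 1"
  shows "(\<lambda>l::int. r ^ nat \<bar>l\<bar>) summable_on UNIV"
proof -
  have geo: "(\<lambda>n. r ^ n) summable_on (UNIV :: nat set)"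
    using assms by (simp add: summable_on_UNIV_nonneg_real_iff)
  have "bij_betw int UNIV {0..}" by (rule bij_betwI[of _ _ _ nat]) auto
  from summable_on_reindex_bij_betw[OF this, of "\<lambda>l. r ^ nat \<bar>l\<bar>"] geo
  have pos: "(\<lambda>l::int. r ^ nat \<bar>l\<bar>) summable_on {0..}" by simp
  have "bij_betw (\<lambda>n. - int n) UNIV {..0}" by (rule bij_betwI[of _ _ _ "\<lambda>l. nat (- l)"]) auto
  from summable_on_reindex_bij_betw[OF this, of "\<lambda>l. r ^ nat \<bar>l\<bar>"] geo
  have neg: "(\<lambda>l::int. r ^ nat \<bar>l\<bar>) summable_on {..0}" by simp
  have "(\<lambda>l::int. r ^ nat \<bar>l\<bar>) summable_on ({0..} \<union> {..0})"
    by (rule summable_on_union[OF pos neg])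
  moreover have "{0..} \<union> {..0} = (UNIV :: int set)" by auto
  ultimately show ?thesis by simp
qed

text \<open>
  On the circle \<open>1/a = cnj a / \<bar>a\<bar>\<^sup>2 = cnj a (\<Sum>k. (1 - \<bar>a\<bar>\<^sup>2)\<^sup>k)\<close>. Multiplying by \<open>cnj a\<close> makes the
  quantity in the geometric series real and smaller than \<open>1\<close>, although \<open>a\<close> itself may be complex.
  A bound on a symbol bounds its coefficients, and the bands give the decay.
\<close>

theorem banded_inverse_exponential_decay:
  assumes a: "banded K a" and m: "m > 0"
    and low: "\<And>z. cmod z = 1 \<Longrightarrow> m \<le> cmod (symbol a z)"
    and up: "\<And>z. cmod z = 1 \<Longrightarrow> cmod (symbol a z) \<le> 1"
  shows "\<exists>g C r. is_l1_inverse a g \<and> 0 < C \<and> 0 < r \<and> r < 1 \<and> (\<forall>l. \<bar>g l\<bar> \<le> C * r ^ nat \<bar>l\<bar>)"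
proof -
  \<comment> \<open>Lowering the bound to at most \<open>1/2\<close> keeps the contraction factor \<open>q\<close> positive, so that the
    decay rates \<open>s\<close> and \<open>r\<close> extracted from it by roots lie strictly between \<open>0\<close> and \<open>1\<close>.\<close>
  define m' where "m' = min m (1 / 2)"
  define q where "q = 1 - m'\<^sup>2"
  have m': "0 < m'" "m' \<le> 1 / 2" "m' \<le> m" using m by (auto simp: m'_def)
  have "m'\<^sup>2 \<le> (1 / 2)\<^sup>2" using m' by (intro power_mono) auto
  then have "0 < m'\<^sup>2" "m'\<^sup>2 < 1" using m' by (auto simp: power2_eq_square)
  then have q: "0 < q" "q < 1" by (auto simp: q_def)
  have contraction: "1 - (cmod (symbol a z))\<^sup>2 \<in> {0..q}" if "cmod z = 1" for z
  proof -
    have "m'\<^sup>2 \<le> (cmod (symbol a z))\<^sup>2"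
      using m' low[OF that] by (intro power_mono) auto
    moreover have "(cmod (symbol a z))\<^sup>2 \<le> 1" using up[OF that] by (simp add: power_le_one)
    ultimately show ?thesis by (simp add: q_def)
  qed
  obtain e where e: "\<And>k. banded (K + k * (2 * K)) (e k)"
    "\<And>k z. cmod z = 1 \<Longrightarrow>
       symbol (e k) z = cnj (symbol a z) * (1 - of_real ((cmod (symbol a z))\<^sup>2)) ^ k"
    using banded_neumann_term[OF a] by metis
  have e_bound: "\<bar>e k l\<bar> \<le> q ^ k" for k l
  proof (rule coefficient_bound[OF banded_l1[OF e(1)]])
    fix z :: complex assume z: "cmod z = 1"
    have "cmod (symbol (e k) z) = cmod (symbol a z) * \<bar>1 - (cmod (symbol a z))\<^sup>2\<bar> ^ k"
      unfolding e(2)[OF z] norm_mult norm_power complex_mod_cnj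
      by (metis norm_of_real of_real_1 of_real_diff)
    also have "\<dots> \<le> 1 * q ^ k"
      using up[OF z] contraction[OF z] by (intro mult_mono power_mono) auto
    finally show "cmod (symbol (e k) z) \<le> q ^ k" by simp
  qed
  define s where "s = sqrt q"
  define r where "r = root (Suc (2 * K)) s"
  have s: "0 < s" "s < 1" "s * s = q" using q by (auto simp: s_def)
  have r: "0 < r" "r < 1" "r ^ Suc (2 * K) = s"
    using s by (auto simp: r_def real_root_gt_zero real_root_lt_1_iff simp del: power_Suc)
  \<comment> \<open>A nonzero entry at \<open>l\<close> forces \<open>\<bar>l\<bar> \<le> K + 2 K k\<close>, so half of the decay in \<open>k\<close> can be traded
    for decay in \<open>l\<close>.\<close>
  have split: "\<bar>e k l\<bar> \<le> s ^ k * (inverse (r ^ K) * r ^ nat \<bar>l\<bar>)" for k l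
  proof (cases "e k l = 0")
    case True
    then show ?thesis using s r by simp
  next
    case False
    then have "\<bar>l\<bar> \<le> int (K + k * (2 * K))" using e(1)[of k] unfolding banded_def by blast
    then have "nat \<bar>l\<bar> \<le> K + k * (2 * K)" by linarith
    also have "\<dots> \<le> K + k * Suc (2 * K)" by simp
    finally have "nat \<bar>l\<bar> \<le> K + k * Suc (2 * K)" .
    then have "r ^ (K + k * Suc (2 * K)) \<le> r ^ nat \<bar>l\<bar>" using r by (intro power_decreasing) auto
    moreover have "r ^ (K + k * Suc (2 * K)) = r ^ K * s ^ k"
      by (metis power_add power_mult mult.commute r(3))
    ultimately have "s ^ k \<le> inverse (r ^ K) * r ^ nat \<bar>l\<bar>"
      using r(1) by (simp add: field_simps)
    then have "s ^ k * s ^ k \<le> s ^ k * (inverse (r ^ K) * r ^ nat \<bar>l\<bar>)"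
      using s(1) by (intro mult_left_mono) auto
    moreover have "q ^ k = s ^ k * s ^ k" by (simp flip: s(3) power_mult_distrib)
    ultimately show ?thesis using e_bound[of k l] by simp
  qed
  define D where "D = inverse (r ^ K)"
  have D: "D > 0" using r by (simp add: D_def)
  have geo: "((\<lambda>k. s ^ k) has_sum 1 / (1 - s)) UNIV"
    using s by (intro sums_nonneg_imp_has_sum geometric_sums) auto
  have geo_l: "(\<lambda>l::int. D * r ^ nat \<bar>l\<bar>) summable_on UNIV"
    by (intro summable_on_cmult_right geometric_int_summable r)
  have dominating: "(\<lambda>(k, l::int). s ^ k * (D * r ^ nat \<bar>l\<bar>)) summable_on UNIV \<times> UNIV"
  proof (rule summable_on_SigmaI)
    show "((\<lambda>l::int. case (k, l) of (k, l) \<Rightarrow> s ^ k * (D * r ^ nat \<bar>l\<bar>))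
        has_sum s ^ k * (\<Sum>\<^sub>\<infinity>l::int. D * r ^ nat \<bar>l\<bar>)) UNIV" for k
      using has_sum_cmult_right[OF has_sum_infsum[OF geo_l], of "s ^ k"] by simp
    show "(\<lambda>k. s ^ k * (\<Sum>\<^sub>\<infinity>l::int. D * r ^ nat \<bar>l\<bar>)) summable_on UNIV"
      by (rule summable_on_cmult_left[OF has_sum_imp_summable[OF geo]])
  qed (use s D r in auto)
  define g where "g l = (\<Sum>\<^sub>\<infinity>k. e k l)" for l
  have col: "(\<lambda>k. s ^ k * (D * r ^ nat \<bar>l\<bar>)) summable_on UNIV" for l :: int
    by (rule summable_on_cmult_left[OF has_sum_imp_summable[OF geo]])
  have e_col: "((\<lambda>k. e k l) has_sum g l) UNIV" for l
    unfolding g_def using split[of _ l]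
    by (intro has_sum_infsum abs_summable_summable[OF Infinite_Sum.abs_summable_on_comparison_test'[OF col[of l]]])
      (simp add: D_def)
  have g_bound: "\<bar>g l\<bar> \<le> D / (1 - s) * r ^ nat \<bar>l\<bar>" for l
  proof -
    have "norm (g l) \<le> 1 / (1 - s) * (D * r ^ nat \<bar>l\<bar>)"
      by (rule norm_infsum_le[OF e_col has_sum_cmult_left[OF geo]]) (use split in \<open>simp add: D_def\<close>)
    then show ?thesis by simp
  qed
  have g_l1: "g \<in> l1"
  proof -
    have "(\<lambda>l::int. D / (1 - s) * r ^ nat \<bar>l\<bar>) summable_on UNIV"
      by (intro summable_on_cmult_right geometric_int_summable r)
    then have "(\<lambda>l. norm (g l)) summable_on UNIV"
      by (rule Infinite_Sum.abs_summable_on_comparison_test') (use g_bound in simp)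
    then show ?thesis by (simp add: l1_def)
  qed
  have "symbol g z * symbol a z = 1" if z: "cmod z = 1" for z
  proof -
    define A where "A = symbol a z"
    define B where "B = 1 - complex_of_real ((cmod A)\<^sup>2)"
    have "(\<lambda>x. norm (case x of (k, l) \<Rightarrow> of_real (e k l) * z powi l)) summable_on UNIV \<times> UNIV"
      by (rule Infinite_Sum.abs_summable_on_comparison_test'[OF dominating])
        (use split z in \<open>auto simp: norm_mult norm_power_int D_def\<close>)
    then have summ: "(\<lambda>(k, l). of_real (e k l) * z powi l) summable_on UNIV \<times> UNIV"
      by (rule abs_summable_summable)
    have "symbol g z = (\<Sum>\<^sub>\<infinity>l. \<Sum>\<^sub>\<infinity>k. of_real (e k l) * z powi l)"
      unfolding symbol_def
      by (intro infsum_cong infsumI[symmetric] has_sum_cmult_left has_sum_of_real e_col)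
    also have "\<dots> = (\<Sum>\<^sub>\<infinity>k. symbol (e k) z)"
      unfolding symbol_def by (rule infsum_swap_banach[OF summ, symmetric])
    also have "\<dots> = (\<Sum>\<^sub>\<infinity>k. cnj A * B ^ k)"
      by (simp add: e(2)[OF z] A_def B_def)
    also have "\<dots> = cnj A * (1 / (1 - B))"
    proof (intro infsumI has_sum_cmult_right norm_summable_imp_has_sum)
      have "B = of_real (1 - (cmod A)\<^sup>2)" by (simp add: B_def)
      then have "norm B = \<bar>1 - (cmod A)\<^sup>2\<bar>" by (simp only: norm_of_real)
      then have "norm B \<le> q" using contraction[OF z] by (simp add: A_def)
      then have "norm B < 1" using q by simp
      then show "summable (\<lambda>k. norm (B ^ k))" "(\<lambda>k. B ^ k) sums (1 / (1 - B))"
        by (simp_all add: norm_power geometric_sums)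
    qed
    also have "1 - B = A * cnj A" unfolding B_def by (metis complex_norm_square of_real_power add_diff_cancel_right' diff_diff_eq2 add.commute)
    finally show ?thesis
      using low[OF z] m by (auto simp: A_def)
  qed
  then have "is_l1_inverse a g"
    using banded_l1[OF a] g_l1 by (simp add: is_l1_inverse_def)
  moreover have "0 < D / (1 - s)" using D s by simp
  ultimately show ?thesis using g_bound r by blast
qed

section \<open>Truncated binomial series\<close>

text \<open>
  The Taylor polynomial of degree \<open>\<nu>\<close> of \<open>(1 - t) powr (- a)\<close> at \<open>0\<close>.
\<close>

definition binomial_truncation :: "real \<Rightarrow> nat \<Rightarrow> real \<Rightarrow> real" where
  "binomial_truncation a \<nu> t = (\<Sum>j=0..\<nu>. ((a + real j - 1) gchoose j) * t ^ j)"

text \<open>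
  The coefficient of the one term by which the truncated series fails to satisfy the differential
  equation \<open>(1 - t) P' = a P\<close> of \<open>(1 - t) powr (- a)\<close>.
\<close>

definition truncation_defect :: "real \<Rightarrow> nat \<Rightarrow> real" where
  "truncation_defect a \<nu> = (a + real \<nu>) * ((a + real \<nu> - 1) gchoose \<nu>)"

lemma binomial_truncation_coeff_pos:
  assumes "a > 0"
  shows "((a + real j - 1) gchoose j) > (0::real)"
  using pochhammer_pos[OF assms, of j] by (simp add: gbinomial_pochhammer')

lemma truncation_defect_pos: "a > 0 \<Longrightarrow> truncation_defect a \<nu> > 0"
  using binomial_truncation_coeff_pos[of a \<nu>] by (simp add: truncation_defect_def)

lemma binomial_truncation_0: "binomial_truncation a \<nu> 0 = 1"
proof -
  have "binomial_truncation a \<nu> 0 = (\<Sum>j=0..\<nu>. if j = 0 then 1 else 0)"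
    unfolding binomial_truncation_def by (rule sum.cong) auto
  then show ?thesis by simp
qed

lemma binomial_truncation_pos:
  assumes "a > 0" "t \<ge> 0"
  shows "binomial_truncation a \<nu> t > 0"
proof -
  have "0 < (\<Sum>j\<in>{0}. ((a + real j - 1) gchoose j) * t ^ j)" by simp
  also have "\<dots> \<le> binomial_truncation a \<nu> t"
    unfolding binomial_truncation_def using assms
    by (intro sum_mono2 mult_nonneg_nonneg less_imp_le[OF binomial_truncation_coeff_pos]) auto
  finally show ?thesis .
qed

lemma binomial_truncation_half:
  "2 ^ \<nu> * binomial_truncation a \<nu> (1 / 2) = (\<Sum>j=0..\<nu>. (a + real \<nu>) gchoose j)"
proof -
  have "2 ^ \<nu> * binomial_truncation a \<nu> (1 / 2)
      = (\<Sum>j\<le>\<nu>. (real j + a - 1 gchoose j) * 1 ^ j * (1 + 1) ^ (\<nu> - j))"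
    unfolding binomial_truncation_def sum_distrib_left atMost_atLeast0
    by (rule sum.cong) (auto simp: power_diff power_divide add.commute)
  also have "\<dots> = (\<Sum>j\<le>\<nu>. (real \<nu> + a gchoose j) * 1 ^ j * 1 ^ (\<nu> - j))"
    by (rule gbinomial_partial_sum_poly_xpos[symmetric])
  finally show ?thesis by (simp add: atMost_atLeast0 add.commute)
qed

text \<open>
  Adding the term of degree \<open>\<nu> + 1\<close> cancels the old defect, by the absorption identity for binomial
  coefficients, and creates a new one of the next degree.
\<close>

lemma binomial_truncation_ode:
  "\<exists>P'. (binomial_truncation a \<nu> has_real_derivative P') (at t) \<and>
     (1 - t) * P' = a * binomial_truncation a \<nu> t - truncation_defect a \<nu> * t ^ \<nu>"
proof (induction \<nu>)
  case 0
  have "binomial_truncation a 0 = (\<lambda>t. 1)" by (auto simp: binomial_truncation_def)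
  then show ?case by (auto intro!: exI[of _ 0] simp: truncation_defect_def)
next
  case (Suc \<nu>)
  then obtain P' where P': "(binomial_truncation a \<nu> has_real_derivative P') (at t)"
    "(1 - t) * P' = a * binomial_truncation a \<nu> t - truncation_defect a \<nu> * t ^ \<nu>" by blast
  define B where "B = ((a + real (Suc \<nu>) - 1) gchoose Suc \<nu>)"
  have rec: "binomial_truncation a (Suc \<nu>) = (\<lambda>t. binomial_truncation a \<nu> t + B * t ^ Suc \<nu>)"
    by (simp add: binomial_truncation_def B_def fun_eq_iff)
  have C: "truncation_defect a \<nu> = real (Suc \<nu>) * B"
    unfolding B_def truncation_defect_def gbinomial_absorption by (simp add: add.commute)
  have "(binomial_truncation a (Suc \<nu>) has_real_derivative
      P' + B * (real (Suc \<nu>) * t ^ \<nu>)) (at t)"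
    unfolding rec using DERIV_add[OF P'(1) DERIV_cmult[OF DERIV_pow[of "Suc \<nu>" t], of B]] by simp
  moreover have "(1 - t) * (P' + B * (real (Suc \<nu>) * t ^ \<nu>))
      = a * binomial_truncation a (Suc \<nu>) t - truncation_defect a (Suc \<nu>) * t ^ Suc \<nu>"
  proof -
    have "truncation_defect a (Suc \<nu>) = (a + real (Suc \<nu>)) * B"
      by (simp add: truncation_defect_def B_def)
    then show ?thesis unfolding rec C distrib_left P'(2) by (simp add: algebra_simps)
  qed
  ultimately show ?case by blast
qed

lemma weighted_truncation_derivative:
  assumes "m > 0"
  shows "((\<lambda>t. (1 - t) ^ m * binomial_truncation (real m) \<nu> t) has_real_derivative
    - (truncation_defect (real m) \<nu> * ((1 - t) ^ (m - 1) * t ^ \<nu>))) (at t)"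
proof -
  obtain P' where P': "(binomial_truncation (real m) \<nu> has_real_derivative P') (at t)"
    "(1 - t) * P' = real m * binomial_truncation (real m) \<nu> t - truncation_defect (real m) \<nu> * t ^ \<nu>"
    using binomial_truncation_ode by blast
  obtain k where k: "m = Suc k" using assms gr0_conv_Suc by blast
  have "(1 - t) ^ m * P' - real m * (1 - t) ^ (m - 1) * binomial_truncation (real m) \<nu> t
      = (1 - t) ^ (m - 1) * ((1 - t) * P' - real m * binomial_truncation (real m) \<nu> t)"
    by (simp add: k algebra_simps)
  also have "\<dots> = - (truncation_defect (real m) \<nu> * ((1 - t) ^ (m - 1) * t ^ \<nu>))"
    unfolding P'(2) by simp
  finally show ?thesis
    by (auto intro!: derivative_eq_intros P'(1) simp: mult_ac)
qed

text \<open>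
  For odd \<open>n\<close> the weight \<open>(1 - t) powr (n / 2)\<close> has a half-integer exponent. Squaring the weighted
  truncation gives a polynomial again.
\<close>

lemma squared_truncation_derivative:
  assumes "n > 0"
  shows "((\<lambda>t. (1 - t) ^ n * (binomial_truncation (real n / 2) \<nu> t)\<^sup>2) has_real_derivative
    - (2 * truncation_defect (real n / 2) \<nu> *
        ((1 - t) ^ (n - 1) * t ^ \<nu> * binomial_truncation (real n / 2) \<nu> t))) (at t)"
proof -
  let ?P = "binomial_truncation (real n / 2) \<nu>"
  obtain P' where P': "(?P has_real_derivative P') (at t)"
    "(1 - t) * P' = real n / 2 * ?P t - truncation_defect (real n / 2) \<nu> * t ^ \<nu>"
    using binomial_truncation_ode by blast
  obtain k where k: "n = Suc k" using assms gr0_conv_Suc by blast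
  have "(1 - t) ^ n * (2 * ?P t * P') - real n * (1 - t) ^ (n - 1) * (?P t)\<^sup>2
      = 2 * (1 - t) ^ (n - 1) * ?P t * ((1 - t) * P' - real n / 2 * ?P t)"
    by (simp add: k algebra_simps power2_eq_square)
  also have "\<dots> = - (2 * truncation_defect (real n / 2) \<nu> * ((1 - t) ^ (n - 1) * t ^ \<nu> * ?P t))"
    unfolding P'(2) by simp
  finally show ?thesis
    by (auto intro!: derivative_eq_intros P'(1) simp: mult_ac)
qed

text \<open>
  On the left half of the interval \<open>t \<le> 1 - t\<close>, so the product is larger when the higher power falls
  on \<open>1 - t\<close>.
\<close>

lemma power_exchange_le:
  fixes t :: real
  assumes "0 \<le> t" "t \<le> 1 / 2" "j \<le> p"
  shows "t ^ p * (1 - t) ^ j \<le> (1 - t) ^ p * t ^ j"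
proof -
  obtain d where d: "p = j + d" using assms(3) le_Suc_ex by blast
  have "t ^ d * (t ^ j * (1 - t) ^ j) \<le> (1 - t) ^ d * (t ^ j * (1 - t) ^ j)"
    using assms by (intro mult_right_mono power_mono) auto
  then show ?thesis by (simp add: d power_add mult_ac)
qed

text \<open>
  The symmetrization has derivative \<open>c (1 - t) - c t \<le> 0\<close> on the left half and takes the same values
  on the right half.
\<close>

lemma symmetrized_bounds:
  fixes F c :: "real \<Rightarrow> real"
  assumes F: "\<And>t. (F has_real_derivative - c t) (at t)"
    and c: "\<And>t. 0 \<le> t \<Longrightarrow> t \<le> 1 / 2 \<Longrightarrow> c (1 - t) \<le> c t"
    and t: "0 \<le> t" "t \<le> 1"
  shows "2 * F (1 / 2) \<le> F t + F (1 - t)" "F t + F (1 - t) \<le> F 0 + F 1"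
proof -
  define f where "f t = F t + F (1 - t)" for t
  have deriv: "(f has_real_derivative - c t + c (1 - t)) (at t)" for t
    unfolding f_def by (auto intro!: derivative_eq_intros F DERIV_chain2[OF F])
  have decr: "f y \<le> f x" if "0 \<le> x" "x \<le> y" "y \<le> 1 / 2" for x y
    by (rule DERIV_nonpos_imp_nonincreasing[OF that(2)]) (use deriv c that in force)
  have half: "f (1 / 2) \<le> f t \<and> f t \<le> f 0" if "0 \<le> t" "t \<le> 1 / 2" for t
    using decr[of t "1 / 2"] decr[of 0 t] that by simp
  have sym: "f (1 - t) = f t" by (simp add: f_def)
  have "f (1 / 2) \<le> f t \<and> f t \<le> f 0"
    using half[of t] half[of "1 - t"] t sym by (cases "t \<le> 1 / 2") auto
  then show "2 * F (1 / 2) \<le> F t + F (1 - t)" "F t + F (1 - t) \<le> F 0 + F 1"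
    by (auto simp: f_def)
qed

lemma weighted_truncation_bounds:
  assumes "\<nu> < m" "0 \<le> t" "t \<le> 1"
  defines "F \<equiv> \<lambda>t. (1 - t) ^ m * binomial_truncation (real m) \<nu> t"
  shows "2 * F (1 / 2) \<le> F t + F (1 - t)" "F t + F (1 - t) \<le> 1"
proof -
  define c where "c t = truncation_defect (real m) \<nu> * ((1 - t) ^ (m - 1) * t ^ \<nu>)" for t
  have "(F has_real_derivative - c t) (at t)" for t
    unfolding F_def c_def by (rule weighted_truncation_derivative) (use assms in simp)
  moreover have "c (1 - t) \<le> c t" if "0 \<le> t" "t \<le> 1 / 2" for t
    unfolding c_def using power_exchange_le[OF that, of \<nu> "m - 1"] assms(1)
    by (intro mult_left_mono less_imp_le[OF truncation_defect_pos]) auto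
  moreover have "F 0 + F 1 = 1" using assms(1) by (simp add: F_def binomial_truncation_0)
  ultimately show "2 * F (1 / 2) \<le> F t + F (1 - t)" "F t + F (1 - t) \<le> 1"
    using symmetrized_bounds[of F c t] assms(2,3) by auto
qed

text \<open>
  The coefficients of the truncated series are positive, so the required inequality between \<open>c t\<close>
  and \<open>c (1 - t)\<close> holds term by term; the exponents satisfy \<open>\<nu> + j \<le> 2 \<nu> \<le> n - 1\<close>.
\<close>

lemma squared_truncation_bounds:
  assumes "2 * \<nu> < n" "0 \<le> t" "t \<le> 1"
  defines "F \<equiv> \<lambda>t. (1 - t) ^ n * (binomial_truncation (real n / 2) \<nu> t)\<^sup>2"
  shows "2 * F (1 / 2) \<le> F t + F (1 - t)" "F t + F (1 - t) \<le> 1"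
proof -
  let ?P = "binomial_truncation (real n / 2) \<nu>"
  define c where "c t = 2 * truncation_defect (real n / 2) \<nu> * ((1 - t) ^ (n - 1) * t ^ \<nu> * ?P t)" for t
  have "(F has_real_derivative - c t) (at t)" for t
    unfolding F_def c_def by (rule squared_truncation_derivative) (use assms in simp)
  moreover have "c (1 - t) \<le> c t" if t: "0 \<le> t" "t \<le> 1 / 2" for t
  proof -
    let ?b = "\<lambda>j. (real n / 2 + real j - 1) gchoose j"
    have "t ^ (n - 1) * (1 - t) ^ \<nu> * ?P (1 - t)
        = (\<Sum>j=0..\<nu>. ?b j * (t ^ (n - 1) * (1 - t) ^ (\<nu> + j)))"
      by (simp add: binomial_truncation_def sum_distrib_left power_add mult_ac)
    also have "\<dots> \<le> (\<Sum>j=0..\<nu>. ?b j * ((1 - t) ^ (n - 1) * t ^ (\<nu> + j)))"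
      using assms(1) t
      by (intro sum_mono mult_left_mono power_exchange_le
          less_imp_le[OF binomial_truncation_coeff_pos]) auto
    also have "\<dots> = (1 - t) ^ (n - 1) * t ^ \<nu> * ?P t"
      by (simp add: binomial_truncation_def sum_distrib_left power_add mult_ac)
    finally show ?thesis
      unfolding c_def using assms(1)
      by (intro mult_left_mono mult_nonneg_nonneg less_imp_le[OF truncation_defect_pos]) auto
  qed
  moreover have "F 0 + F 1 = 1" using assms(1) by (simp add: F_def binomial_truncation_0)
  ultimately show "2 * F (1 / 2) \<le> F t + F (1 - t)" "F t + F (1 - t) \<le> 1"
    using symmetrized_bounds[of F c t] assms(2,3) by auto
qed

section \<open>Pseudo-spline symbols on the unit circle\<close>

text \<open>
  In \<open>a(z) + a(- z)\<close> the odd powers cancel and the even ones double.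
\<close>

lemma symbol_even_part:
  assumes fin: "finite {k. a k \<noteq> 0}" and z: "z \<noteq> 0"
  shows "symbol (even_part a) (z\<^sup>2) = (symbol a z + symbol a (- z)) / 2"
proof -
  obtain K0 where K0: "banded K0 a" using finite_support_banded[OF fin] by blast
  define K where "K = int K0"
  have K: "{k. a k \<noteq> 0} \<subseteq> {-K..K}"
  proof
    fix k assume "k \<in> {k. a k \<noteq> 0}"
    then have "\<bar>k\<bar> \<le> K" using K0 by (simp add: banded_def K_def)
    then show "k \<in> {-K..K}" by auto
  qed
  let ?g = "\<lambda>k. of_real (a k) * z powi k :: complex"
  have "symbol a z + symbol a (- z) = (\<Sum>k\<in>{-K..K}. ?g k + of_real (a k) * (- z) powi k)"
    using K by (simp add: symbol_eq_sum[of "{-K..K}"] sum.distrib)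
  also have "\<dots> = (\<Sum>k\<in>{-K..K}. if even k then 2 * ?g k else 0)"
    by (rule sum.cong) (auto simp: power_int_minus_left)
  also have "\<dots> = (\<Sum>k\<in>{k\<in>{-K..K}. even k}. 2 * ?g k)"
    by (rule sum.inter_filter[symmetric]) simp
  also have "\<dots> = 2 * (\<Sum>k\<in>{k\<in>{-K..K}. even k}. ?g k)"
    by (simp only: sum_distrib_left)
  also have "(\<Sum>k\<in>{k\<in>{-K..K}. even k}. ?g k) = (\<Sum>l\<in>{l. 2 * l \<in> {-K..K}}. ?g (2 * l))"
    by (rule sum.reindex_bij_witness[of _ "\<lambda>l. 2 * l" "\<lambda>k. k div 2"]) auto
  also have "\<dots> = symbol (even_part a) (z\<^sup>2)"
  proof -
    have "finite {l. 2 * l \<in> {-K..K}}"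
      by (rule finite_subset[of _ "{-K..K}"]) auto
    moreover have "{l. even_part a l \<noteq> 0} \<subseteq> {l. 2 * l \<in> {-K..K}}"
      using K by (auto simp: even_part_def)
    ultimately show ?thesis
      by (subst symbol_eq_sum) (auto simp: even_part_def power_int_mult)
  qed
  finally show ?thesis by simp
qed

text \<open>
  On the circle \<open>1 - t = (1 + z)\<^sup>2 / (4 z)\<close>, which absorbs the monomial factor and all but \<open>e\<close> of the
  factors \<open>1 + z\<close>.
\<close>

lemma pseudo_spline_symbol_circle:
  assumes z: "cmod z = 1" and n: "n = 2 * m + e" "e \<le> 1" "m > 0"
  defines "t \<equiv> (1 - Re z) / 2"
  shows "pseudo_spline_symbol n \<nu> z =
    2 * of_real ((1 - t) ^ m * binomial_truncation (real n / 2) \<nu> t) * ((1 + z) / 2) ^ e"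
proof -
  have "z \<noteq> 0" using z by auto
  have inv: "inverse z = cnj z"
    using cnj_powi_unit_circle[OF z, of 1] by (simp add: power_int_minus)
  have arg: "1 / 2 - (z + inverse z) / 4 = of_real t"
    unfolding inv by (simp add: t_def complex_add_cnj complex_eq_iff)
  have "(1 + z)\<^sup>2 = z * (2 + (z + inverse z))"
    using \<open>z \<noteq> 0\<close> by (simp add: field_simps power2_eq_square)
  also have "2 + (z + inverse z) = of_real (4 * (1 - t))"
    using arg by (simp add: field_simps)
  finally have sq: "(1 + z) ^ (2 * m) = z ^ m * of_real ((4 * (1 - t)) ^ m)"
    by (simp add: power_mult power_mult_distrib)
  have "z powi (- int (n div 2)) = inverse (z ^ m)"
    using n by (simp add: power_int_minus)
  then have "z powi (- int (n div 2)) * (1 + z) ^ n = of_real ((4 * (1 - t)) ^ m) * (1 + z) ^ e"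
    unfolding n(1) power_add sq using \<open>z \<noteq> 0\<close> by simp
  then have "pseudo_spline_symbol n \<nu> z =
      4 ^ m * of_real (1 - t) ^ m * (1 + z) ^ e / 2 ^ (n - 1) * of_real (binomial_truncation (real n / 2) \<nu> t)"
    unfolding pseudo_spline_symbol_def arg
    by (simp only: binomial_truncation_def of_real_power of_real_mult of_real_numeral of_real_sum
        power_mult_distrib)
  moreover have "(4::complex) ^ m = 2 * 2 ^ (n - 1) / 2 ^ e"
  proof -
    have "(2::complex) ^ e * 4 ^ m = 2 ^ n"
      using n(1) by (simp add: power_mult power_add)
    also have "\<dots> = 2 * 2 ^ (n - 1)" using n by (simp flip: power_Suc)
    finally show ?thesis by (simp add: field_simps)
  qed
  ultimately show ?thesis by (simp add: power_divide)
qed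

text \<open>
  The numbers \<open>(1 + z) / 2\<close> and \<open>(1 - z) / 2\<close> are orthogonal as plane vectors, with squared lengths
  \<open>1 - t\<close> and \<open>t\<close> for \<open>t = (1 - Re z) / 2\<close>.
\<close>

lemma cmod_odd_combination:
  assumes "cmod z = 1"
  shows "(cmod (of_real A * ((1 + z) / 2) + of_real B * ((1 - z) / 2)))\<^sup>2
    = (1 - (1 - Re z) / 2) * A\<^sup>2 + (1 - Re z) / 2 * B\<^sup>2"
proof -
  have "(Re z)\<^sup>2 + (Im z)\<^sup>2 = 1" using assms by (simp flip: cmod_power2)
  then have im: "(Im z)\<^sup>2 = 1 - (Re z)\<^sup>2" by simp
  define w where "w = of_real A * ((1 + z) / 2) + of_real B * ((1 - z) / 2)"
  have parts: "Re w = (A + B + (A - B) * Re z) / 2" "Im w = (A - B) * Im z / 2"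
    by (simp_all add: w_def field_simps)
  have "(cmod w)\<^sup>2 = ((A + B + (A - B) * Re z)\<^sup>2 + (A - B)\<^sup>2 * (Im z)\<^sup>2) / 4"
    unfolding cmod_power2 parts
    by (simp only: power_divide power_mult_distrib add_divide_distrib[symmetric]) simp
  then show ?thesis unfolding im w_def[symmetric] by (simp add: power2_eq_square field_simps)
qed

lemma even_part_pseudo_spline_symbol:
  assumes z: "cmod z = 1" and n: "n = 2 * m + e" "e \<le> 1" "m > 0"
  defines "t \<equiv> (1 - Re z) / 2"
  shows "symbol (even_part (pseudo_spline_mask n \<nu>)) (z\<^sup>2) =
    of_real ((1 - t) ^ m * binomial_truncation (real n / 2) \<nu> t) * ((1 + z) / 2) ^ e +
    of_real (t ^ m * binomial_truncation (real n / 2) \<nu> (1 - t)) * ((1 - z) / 2) ^ e"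
proof -
  have "z \<noteq> 0" using z by auto
  have mask: "finite {k. pseudo_spline_mask n \<nu> k \<noteq> 0}"
    "\<And>z. z \<noteq> 0 \<Longrightarrow> symbol (pseudo_spline_mask n \<nu>) z = pseudo_spline_symbol n \<nu> z"
    using has_laurent_symbol_pseudo_spline_mask by (auto simp: has_laurent_symbol_def)
  have t': "(1 - Re (- z)) / 2 = 1 - t" "1 - (1 - t) = t" by (simp_all add: t_def field_simps)
  have neg: "pseudo_spline_symbol n \<nu> (- z) =
      2 * of_real (t ^ m * binomial_truncation (real n / 2) \<nu> (1 - t)) * ((1 - z) / 2) ^ e"
    using pseudo_spline_symbol_circle[of "- z" n m e \<nu>] z n unfolding t' by simp
  show ?thesis
    unfolding symbol_even_part[OF mask(1) \<open>z \<noteq> 0\<close>]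
    using \<open>z \<noteq> 0\<close> pseudo_spline_symbol_circle[OF z n, of \<nu>]
    by (simp add: mask(2) neg t_def)
qed

text \<open>
  Every point of the circle is a square \<open>z\<^sup>2\<close>, so bounds in terms of \<open>t = (1 - Re z) / 2\<close> cover the
  whole circle. The point \<open>- 1\<close> is the square of \<open>\<i>\<close>, where \<open>t = 1/2\<close>.
\<close>

lemma even_part_pseudo_spline_modulus:
  fixes n \<nu> :: nat
  assumes \<nu>: "\<nu> < n div 2"
  defines "a \<equiv> even_part (pseudo_spline_mask n \<nu>)"
  defines "\<mu> \<equiv> (\<Sum>j=0..\<nu>. (real n / 2 + real \<nu>) gchoose j) / 2 ^ ((n - 1) div 2 + \<nu>)"
  shows "\<mu> > 0" "cmod (symbol a (- 1)) = \<mu>"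
    and "\<And>w. cmod w = 1 \<Longrightarrow> \<mu> \<le> cmod (symbol a w) \<and> cmod (symbol a w) \<le> 1"
proof -
  let ?P = "binomial_truncation (real n / 2) \<nu>"
  define m where "m = n div 2"
  have m: "m > 0" "\<nu> < m" "n > 0" using \<nu> by (auto simp: m_def)
  have P_nonneg: "?P t \<ge> 0" if "t \<ge> 0" for t
    using binomial_truncation_pos[of "real n / 2" t \<nu>] m that by simp
  have \<mu>: "\<mu> = ?P (1 / 2) / 2 ^ ((n - 1) div 2)"
    unfolding \<mu>_def binomial_truncation_half[symmetric] by (simp add: power_add)
  show "\<mu> > 0" unfolding \<mu> using binomial_truncation_pos[of "real n / 2" "1 / 2" \<nu>] m by simp
  have main: "\<mu> \<le> cmod (symbol a (z\<^sup>2)) \<and> cmod (symbol a (z\<^sup>2)) \<le> 1 \<and>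
      (Re z = 0 \<longrightarrow> cmod (symbol a (z\<^sup>2)) = \<mu>)" if z: "cmod z = 1" for z
  proof -
    define t where "t = (1 - Re z) / 2"
    have "\<bar>Re z\<bar> \<le> 1" using abs_Re_le_cmod[of z] z by simp
    then have t: "0 \<le> t" "t \<le> 1" by (auto simp: t_def)
    show ?thesis
    proof (cases "even n")
      case True
      then have n: "n = 2 * m + 0" "real n / 2 = real m" "(n - 1) div 2 = m - 1"
        using m by (auto simp: m_def)
      define F where "F t = (1 - t) ^ m * ?P t" for t
      have "symbol a (z\<^sup>2) = of_real (F t + F (1 - t))"
        unfolding a_def by (subst even_part_pseudo_spline_symbol[OF z n(1)])
          (use m in \<open>simp_all add: F_def t_def\<close>)
      moreover have "F t + F (1 - t) \<ge> 0"
        using t P_nonneg by (auto simp: F_def)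
      ultimately have cm: "cmod (symbol a (z\<^sup>2)) = F t + F (1 - t)" by (metis norm_of_real abs_of_nonneg)
      have "\<mu> = 2 * F (1 / 2)"
      proof -
        obtain k where "m = Suc k" using m(1) gr0_conv_Suc by blast
        then show ?thesis unfolding \<mu> n(3) by (simp add: F_def power_divide)
      qed
      then show ?thesis
        using weighted_truncation_bounds[OF m(2) t] unfolding cm by (auto simp: F_def n(2) t_def)
    next
      case False
      then have n: "n = 2 * m + 1" "(n - 1) div 2 = m" by (auto simp: m_def elim: oddE)
      define F where "F t = (1 - t) ^ n * (?P t)\<^sup>2" for t
      have F_split: "F t = (1 - t) * ((1 - t) ^ m * ?P t)\<^sup>2" for t
        by (simp add: F_def n(1) power_mult_distrib power_mult mult.commute power2_eq_square)
      have cm: "(cmod (symbol a (z\<^sup>2)))\<^sup>2 = F t + F (1 - t)"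
        using cmod_odd_combination[OF z, of "(1 - t) ^ m * ?P t" "t ^ m * ?P (1 - t)"]
          even_part_pseudo_spline_symbol[OF z n(1) _ m(1), of \<nu>]
        by (simp add: a_def F_split t_def)
      have \<mu>2: "\<mu>\<^sup>2 = 2 * F (1 / 2)"
        unfolding \<mu> n(2) by (simp add: F_split power_divide power_mult_distrib)
      have bounds: "2 * F (1 / 2) \<le> F t + F (1 - t)" "F t + F (1 - t) \<le> 1"
        using squared_truncation_bounds[of \<nu> n t] m t n(1) by (auto simp: F_def)
      have "\<mu> \<le> cmod (symbol a (z\<^sup>2))"
        by (rule power2_le_imp_le) (use bounds \<mu>2 cm in simp_all)
      moreover have "cmod (symbol a (z\<^sup>2)) \<le> 1"
        by (rule power2_le_imp_le) (use bounds cm in simp_all)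
      moreover have "cmod (symbol a (z\<^sup>2)) = \<mu>" if "Re z = 0"
        by (rule power2_eq_imp_eq) (use that cm \<mu>2 \<open>\<mu> > 0\<close> in \<open>simp_all add: t_def\<close>)
      ultimately show ?thesis by blast
    qed
  qed
  show "cmod (symbol a (- 1)) = \<mu>" using main[of \<i>] by simp
  show "\<mu> \<le> cmod (symbol a w) \<and> cmod (symbol a w) \<le> 1" if "cmod w = 1" for w
  proof -
    have "cmod (csqrt w) = 1" using that by (simp add: norm_csqrt)
    then show ?thesis using main[of "csqrt w"] by simp
  qed
qed

lemma even_part_pseudo_spline_at_1:
  assumes "\<nu> < n div 2"
  shows "symbol (even_part (pseudo_spline_mask n \<nu>)) 1 = 1"
proof -
  have n: "n = 2 * (n div 2) + n mod 2" "n mod 2 \<le> 1" "n div 2 > 0" using assms by auto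
  show ?thesis
    using even_part_pseudo_spline_symbol[OF _ n, of 1 \<nu>] assms
    by (simp add: binomial_truncation_0)
qed

lemma even_part_pseudo_spline_finite_support:
  "finite {k. even_part (pseudo_spline_mask n \<nu>) k \<noteq> 0}"
proof -
  have "finite {k. pseudo_spline_mask n \<nu> k \<noteq> 0}"
    using has_laurent_symbol_pseudo_spline_mask by (auto simp: has_laurent_symbol_def)
  then have "finite ((\<lambda>k. 2 * k) -` {k. pseudo_spline_mask n \<nu> k \<noteq> 0})"
    by (rule finite_vimageI) (auto simp: inj_def)
  then show ?thesis by (simp add: even_part_def vimage_def)
qed

section \<open>The even part of a pseudo-spline mask and its inverse\<close>

theorem theorem6:
  fixes n \<nu> :: nat and a :: "int \<Rightarrow> real"
  assumes "int \<nu> \<le> int (n div 2) - 1"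
    and "a = even_part (pseudo_spline_mask n \<nu>)"
  shows "(symbol a 1 = 1 \<and>
      (\<exists>w. cmod w = 1 \<and> (\<forall>z. cmod z = 1 \<longrightarrow> cmod (symbol a z) \<le> cmod (symbol a w)) \<and>
         op_norm2 (toeplitz a) = cmod (symbol a w) \<and> cmod (symbol a w) = 1)) \<and>
    (\<exists>\<gamma>. is_l1_inverse a \<gamma>) \<and>
    (\<forall>\<gamma>. is_l1_inverse a \<gamma> \<longrightarrow>
       symbol \<gamma> 1 = 1 \<and>
       op_norm2 (toeplitz \<gamma>) =
         2 ^ ((n - 1) div 2 + \<nu>) / (\<Sum>j=0..\<nu>. (real n / 2 + real \<nu>) gchoose j) \<and>
       (\<exists>C r. 0 < C \<and> 0 < r \<and> r < 1 \<and> (\<forall>l. \<bar>\<gamma> l\<bar> \<le> C * r ^ nat \<bar>l\<bar>)))"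
proof (intro conjI allI impI)
  have \<nu>: "\<nu> < n div 2" using assms(1) by linarith
  define S where "S = (\<Sum>j=0..\<nu>. (real n / 2 + real \<nu>) gchoose j)"
  define \<mu> where "\<mu> = S / 2 ^ ((n - 1) div 2 + \<nu>)"
  have \<mu>: "\<mu> > 0" "cmod (symbol a (- 1)) = \<mu>"
    and low: "\<And>z. cmod z = 1 \<Longrightarrow> \<mu> \<le> cmod (symbol a z)"
    and up: "\<And>z. cmod z = 1 \<Longrightarrow> cmod (symbol a z) \<le> 1"
    using even_part_pseudo_spline_modulus[OF \<nu>] unfolding \<mu>_def S_def assms(2) by blast+
  obtain K where K: "banded K a"
    using finite_support_banded[OF even_part_pseudo_spline_finite_support] unfolding assms(2) by blast
  have a1: "symbol a 1 = 1"
    unfolding assms(2) by (rule even_part_pseudo_spline_at_1[OF \<nu>])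
  then show "symbol a 1 = 1" .
  have "op_norm2 (toeplitz a) = cmod (symbol a (of_real 1))"
    by (rule op_norm2_toeplitz_peak[OF banded_l1[OF K]]) (simp_all add: a1 up)
  then show "\<exists>w. cmod w = 1 \<and> (\<forall>z. cmod z = 1 \<longrightarrow> cmod (symbol a z) \<le> cmod (symbol a w)) \<and>
      op_norm2 (toeplitz a) = cmod (symbol a w) \<and> cmod (symbol a w) = 1"
    by (intro exI[of _ 1]) (simp add: a1 up)
  obtain g C r where g: "is_l1_inverse a g"
    and decay: "0 < C" "0 < r" "r < 1" "\<And>l. \<bar>g l\<bar> \<le> C * r ^ nat \<bar>l\<bar>"
    using banded_inverse_exponential_decay[OF K \<mu>(1) low up] by blast
  then show "\<exists>\<gamma>. is_l1_inverse a \<gamma>" by blast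
  fix \<gamma> assume \<gamma>: "is_l1_inverse a \<gamma>"
  have recip: "symbol h z = 1 / symbol a z" if "is_l1_inverse a h" "cmod z = 1" for h z
  proof -
    have "symbol a z \<noteq> 0" using low[OF that(2)] \<mu>(1) by auto
    then show ?thesis using that by (simp add: is_l1_inverse_def eq_divide_eq)
  qed
  show "symbol \<gamma> 1 = 1" using recip[OF \<gamma>, of 1] a1 by simp
  have "op_norm2 (toeplitz \<gamma>) = cmod (symbol \<gamma> (of_real (- 1)))"
  proof (rule op_norm2_toeplitz_peak)
    show "\<gamma> \<in> l1" using \<gamma> by (simp add: is_l1_inverse_def)
    show "symbol \<gamma> (of_real (- 1)) \<noteq> 0" using recip[OF \<gamma>, of "- 1"] \<mu> by auto
    show "cmod (symbol \<gamma> z) \<le> cmod (symbol \<gamma> (of_real (- 1)))" if "cmod z = 1" for z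
      using low[OF that] \<mu> recip[OF \<gamma> that] recip[OF \<gamma>, of "- 1"]
      by (simp add: norm_divide frac_le)
  qed simp
  also have "\<dots> = 1 / \<mu>" using recip[OF \<gamma>, of "- 1"] \<mu> by (simp add: norm_divide)
  finally show "op_norm2 (toeplitz \<gamma>) =
      2 ^ ((n - 1) div 2 + \<nu>) / (\<Sum>j=0..\<nu>. (real n / 2 + real \<nu>) gchoose j)"
    by (simp add: \<mu>_def S_def)
  have "\<gamma> = g"
  proof (rule l1_symbol_unique)
    show "symbol \<gamma> z = symbol g z" if "cmod z = 1" for z
      using recip[OF \<gamma> that] recip[OF g that] by simp
  qed (use \<gamma> g in \<open>simp_all add: is_l1_inverse_def\<close>)
  then show "\<exists>C r. 0 < C \<and> 0 < r \<and> r < 1 \<and> (\<forall>l. \<bar>\<gamma> l\<bar> \<le> C * r ^ nat \<bar>l\<bar>)"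
    using decay by blast
qed

end
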